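(* Consider the AHB strategy (described in the context) run with a non-increasing sequence $(\gamma_t)_{t\ge1}$ of extra-exploration rates with $\gamma_t \le 1/2$ for all $t$. Then for all real numbers $m < M$, for all oblivious sequences $y_1, y_2, \dots$ of reward vectors in $[m,M]^K$ and all $T \ge 1$, \[ R_T(y_{1:T}) \le 3(M-m)\sqrt{KT\ln K} + 5(M-m)\frac{K\ln K}{\gamma_T} + (M-m)\sum_{t=K+1}^T \gamma_t . \] In particular, for a parameter $\alpha \in (0,1)$, the choice $\gamma_t = \min\bigl\{1/2,\ \sqrt{5(1-\alpha)K\ln K}\,/\,t^{\alpha}\bigr\}$ ensures, for all $m<M$, all such sequences and all $T\ge1$, \[ R_T(y_{1:T}) \le \Bigl(3 + \frac{5}{\sqrt{1-\alpha}}\Bigr)(M-m)\sqrt{K\ln K}\; T^{\max\{\alpha,1-\alpha\}} + 10(M-m)K\ln K , \] which for $\alpha = 1/2$ reads $R_T(y_{1:T}) \le 7(M-m)\sqrt{TK\ln K} + 10(M-m)K\ln K$.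
   Context: Oblivious adversarial $K$-armed bandits ($K\ge2$): the environment fixes beforehand reward vectors $y_t = (y_{t,a})_{a\in[K]} \in [m,M]^K$, $t\ge1$, with $m<M$ unknown to the player. At each round $t$ the player picks $A_t\in[K]$ (possibly randomized via auxiliary independent uniform variables) and observes only $y_{t,A_t}$. The regret is $R_T(y_{1:T}) = \max_{a\in[K]}\sum_{t=1}^T y_{t,a} - \mathbb{E}[\sum_{t=1}^T y_{t,A_t}]$, the expectation being over the player's randomization. $\ln$ is the natural logarithm. AHB strategy (AdaHedge for $K$-armed bandits with extra-exploration), input $(\gamma_t)_{t\ge1}\subset[0,1]$: for $t=1,\dots,K$ play $A_t=t$ and observe $y_{t,t}$; set $C = \frac1K\sum_{s=1}^K y_{s,s}$, $\eta_{K+1}=+\infty$, $q_{K+1}=(1/K,\dots,1/K)$. For $t\ge K+1$: set $p_t = (1-\gamma_t)q_t + \gamma_t(1/K,\dots,1/K)$; draw $A_t\sim p_t$; observe $y_{t,A_t}$; set $\widehat y_{t,a} = \frac{y_{t,A_t}-C}{p_{t,a}}\mathbf{1}\{A_t=a\} + C$ for all $a$; compute the mixability gap $\delta_t = -\sum_a q_{t,a}\widehat y_{t,a} + \frac1{\eta_t}\ln\bigl(\sum_a q_{t,a} e^{\eta_t \widehat y_{t,a}}\bigr)$ if $\eta_t<\infty$, and $\delta_t = -\sum_a q_{t,a}\widehat y_{t,a} + \max_a \widehat y_{t,a}$ if $\eta_t=+\infty$; set $\eta_{t+1} = \ln K \big/ \sum_{s=K+1}^t \delta_s$; set $q_{t+1,a}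 = \exp\bigl(\eta_{t+1}\sum_{s=K+1}^t \widehat y_{s,a}\bigr)\big/\sum_{k=1}^K \exp\bigl(\eta_{t+1}\sum_{s=K+1}^t \widehat y_{s,k}\bigr)$. *)

theory Defs
  imports Complex_Main
begin

text \<open>Arms are 1..K, rounds are 1,2,...; rewards y t a.
  The internal state after rounds K+1..t-1 is (L, D): L a = sum of estimated
  rewards hat y_{s,a}, D = sum of mixability gaps delta_s (so eta_t = ln K / D,
  with eta_t = +infinity iff D = 0).\<close>

definition ahb_C :: "nat \<Rightarrow> (nat \<Rightarrow> nat \<Rightarrow> real) \<Rightarrow> real" where
  "ahb_C K y = (\<Sum>s=1..K. y s s) / real K"

definition ahb_eta :: "nat \<Rightarrow> real \<Rightarrow> real" where
  "ahb_eta K D = ln (real K) / D"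

text \<open>Leaders (used when eta = +infinity, the standard AdaHedge convention;
  this gives the uniform distribution at t = K+1).\<close>
definition ahb_leaders :: "nat \<Rightarrow> (nat \<Rightarrow> real) \<Rightarrow> nat set" where
  "ahb_leaders K L = {a \<in> {1..K}. \<forall>b\<in>{1..K}. L b \<le> L a}"

definition ahb_q :: "nat \<Rightarrow> (nat \<Rightarrow> real) \<times> real \<Rightarrow> nat \<Rightarrow> real" where
  "ahb_q K st a = (let L = fst st; D = snd st in
     if D = 0 then (if a \<in> ahb_leaders K L then 1 / real (card (ahb_leaders K L)) else 0)
     else exp (ahb_eta K D * L a) / (\<Sum>k=1..K. exp (ahb_eta K D * L k)))"

definition ahb_p :: "nat \<Rightarrow> (nat \<Rightarrow> real) \<Rightarrow> nat \<Rightarrow> (nat \<Rightarrow> real) \<times> real \<Rightarrow> nat \<Rightarrow> real" where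
  "ahb_p K \<gamma> t st a = (1 - \<gamma> t) * ahb_q K st a + \<gamma> t / real K"

definition ahb_yhat :: "nat \<Rightarrow> (nat \<Rightarrow> real) \<Rightarrow> (nat \<Rightarrow> nat \<Rightarrow> real) \<Rightarrow> nat
    \<Rightarrow> (nat \<Rightarrow> real) \<times> real \<Rightarrow> nat \<Rightarrow> nat \<Rightarrow> real" where
  "ahb_yhat K \<gamma> y t st A a =
     (if a = A then (y t A - ahb_C K y) / ahb_p K \<gamma> t st a else 0) + ahb_C K y"

definition ahb_delta :: "nat \<Rightarrow> (nat \<Rightarrow> real) \<times> real \<Rightarrow> (nat \<Rightarrow> real) \<Rightarrow> real" where
  "ahb_delta K st yh = (let D = snd st; \<eta> = ahb_eta K D in
     if D = 0 then - (\<Sum>a=1..K. ahb_q K st a * yh a) + Max (yh ` {1..K})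
     else - (\<Sum>a=1..K. ahb_q K st a * yh a)
          + (1 / \<eta>) * ln (\<Sum>a=1..K. ahb_q K st a * exp (\<eta> * yh a)))"

definition ahb_update :: "nat \<Rightarrow> (nat \<Rightarrow> real) \<Rightarrow> (nat \<Rightarrow> nat \<Rightarrow> real) \<Rightarrow> nat
    \<Rightarrow> (nat \<Rightarrow> real) \<times> real \<Rightarrow> nat \<Rightarrow> (nat \<Rightarrow> real) \<times> real" where
  "ahb_update K \<gamma> y t st A = (let yh = ahb_yhat K \<gamma> y t st A in
     (\<lambda>a. fst st a + yh a, snd st + ahb_delta K st yh))"

text \<open>Expected total reward collected during n rounds t, t+1, ..., t+n-1,
  starting from internal state st (exact expectation over the randomization:
  A_t is drawn according to the probability vector p_t).\<close>
fun ahb_exp_reward :: "nat \<Rightarrow> (nat \<Rightarrow> real) \<Rightarrow> (nat \<Rightarrow> nat \<Rightarrow> real) \<Rightarrow> nat \<Rightarrow> nat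
    \<Rightarrow> (nat \<Rightarrow> real) \<times> real \<Rightarrow> real" where
  "ahb_exp_reward K \<gamma> y 0 t st = 0"
| "ahb_exp_reward K \<gamma> y (Suc n) t st =
     (\<Sum>a=1..K. ahb_p K \<gamma> t st a *
        (y t a + ahb_exp_reward K \<gamma> y n (Suc t) (ahb_update K \<gamma> y t st a)))"

text \<open>Expected cumulative reward of AHB over rounds 1..T: rounds 1..K are
  deterministic (A_t = t); rounds K+1..T are randomized, starting from
  L = 0, D = 0 (eta_{K+1} = +infinity, q_{K+1} uniform).\<close>
definition ahb_total :: "nat \<Rightarrow> (nat \<Rightarrow> real) \<Rightarrow> (nat \<Rightarrow> nat \<Rightarrow> real) \<Rightarrow> nat \<Rightarrow> real" where
  "ahb_total K \<gamma> y T =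
     (\<Sum>t=1..min T K. y t t) + ahb_exp_reward K \<gamma> y (T - K) (Suc K) (\<lambda>_. 0, 0)"

definition ahb_regret :: "nat \<Rightarrow> (nat \<Rightarrow> real) \<Rightarrow> (nat \<Rightarrow> nat \<Rightarrow> real) \<Rightarrow> nat \<Rightarrow> real" where
  "ahb_regret K \<gamma> y T = Max ((\<lambda>a. \<Sum>t=1..T. y t a) ` {1..K}) - ahb_total K \<gamma> y T"

end

theory Submission
  imports Defs "HOL-Analysis.Convex" "HOL-Analysis.Harmonic_Numbers"
begin

(* AHB is AdaHedge run on importance-weighted estimates yhat of the rewards. They are
   unbiased, and since every arm is explored with probability at least gamma_T / K, they
   exceed their q-mean by at most S = (M - m) K / gamma_T. Along every run, the AdaHedge
   potential Phi = (1/eta) ln (mean_a exp (eta L_a)) of the cumulative estimates L, with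
   eta = ln K / Delta, shows that max_a L_a is at most the cumulated q-mixtures of yhat plus
   2 Delta, where Delta is the cumulated mixability gap. A Bernstein-type bound on each gap
   gives Delta^2 <= ln K * V + (2/3 ln K + 1) S Delta, with V the cumulated q-second moments
   of yhat - C (C is the mean reward of the first K rounds). Taking expectations,
   unbiasedness turns max_a E L_a into the reward of the best arm and the q-mixtures into
   the reward of q_t, which loses at most gamma_t (M - m) against p_t; Jensen's inequality
   together with E V <= 2 K (M - m)^2 T bounds E Delta. The bound for the schedule
   gamma_t ~ t^(-alpha) then follows from sum_t t^(-alpha) <= T^(1-alpha) / (1 - alpha). *)

lemma exp_mult_three_minus_le: "exp u * (3 - u) \<le> 3 + 2 * u + u^2 / 2" for u :: real
proof -
  define k where "k x = 2 + x - exp x * (2 - x)" for x :: real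
  define g where "g x = 3 + 2 * x + x^2 / 2 - exp x * (3 - x)" for x :: real
  have k_deriv: "DERIV k x :> 1 - exp x * (1 - x)" for x
    unfolding k_def by (rule derivative_eq_intros refl | simp add: algebra_simps)+
  have k_deriv_nonneg: "1 - exp x * (1 - x) \<ge> 0" for x :: real
  proof -
    have "exp x * (1 - x) \<le> exp x * exp (-x)"
      using exp_ge_add_one_self[of "-x"] by (simp add: mult_left_mono)
    thus ?thesis by (simp add: exp_minus)
  qed
  have k_mono: "k a \<le> k b" if "a \<le> b" for a b
    by (rule DERIV_nonneg_imp_nondecreasing[OF that]) (use k_deriv k_deriv_nonneg in blast)
  have g_deriv: "DERIV g x :> k x" for x
    unfolding g_def k_def by (rule derivative_eq_intros refl | simp add: algebra_simps)+
  have "k 0 = 0" "g 0 = 0" by (simp_all add: k_def g_def)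
  \<comment> \<open>g' = k is increasing and vanishes at 0, so g attains its minimum 0 at 0.\<close>
  have "g 0 \<le> g u"
  proof (cases "u \<ge> 0")
    case True
    show ?thesis
      by (rule DERIV_nonneg_imp_nondecreasing[OF True]) (use g_deriv k_mono \<open>k 0 = 0\<close> in fastforce)
  next
    case False
    show ?thesis
      by (rule DERIV_nonpos_imp_nonincreasing[of u 0]) (use g_deriv k_mono \<open>k 0 = 0\<close> False in fastforce)+
  qed
  thus ?thesis using \<open>g 0 = 0\<close> by (simp add: g_def)
qed

lemma ln_le_of_le_exp: "0 < x \<Longrightarrow> x \<le> exp y \<Longrightarrow> ln x \<le> y" for x y :: real
  using ln_le_cancel_iff[of x "exp y"] by simp

lemma exp_mult_le_convex_comb: "0 \<le> r \<Longrightarrow> r \<le> 1 \<Longrightarrow> exp (r * w) \<le> 1 - r + r * exp w" for r w :: real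
  using convex_onD[OF exp_convex, of r 0 w] by simp

lemma powr_le_convex_comb: "0 \<le> z \<Longrightarrow> 0 \<le> b \<Longrightarrow> b \<le> 1 \<Longrightarrow> z powr b \<le> 1 - b + b * z" for z b :: real
  using exp_mult_le_convex_comb[of b "ln z"] by (cases "z = 0") (auto simp: powr_def)

lemma sum_powr_neg_le:
  fixes \<alpha> :: real assumes "0 < \<alpha>" "\<alpha> < 1"
  shows "(\<Sum>t=1..T. real t powr (- \<alpha>)) \<le> real T powr (1 - \<alpha>) / (1 - \<alpha>)"
proof (induction T)
  case 0 show ?case by simp
next
  case (Suc T)
  define x where "x = real T + 1"
  define \<beta> where "\<beta> = 1 - \<alpha>"
  have x: "x \<ge> 1" unfolding x_def by auto
  have \<beta>: "0 < \<beta>" "\<beta> < 1" using assms unfolding \<beta>_def by auto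
  have x_powr: "x powr \<beta> / x = x powr (- \<alpha>)"
    using powr_add[of x 1 "- \<alpha>"] x unfolding \<beta>_def by simp
  \<comment> \<open>concavity of powr \<beta>: T^\<beta> \<le> x^\<beta> - \<beta> x^(\<beta>-1)\<close>
  have "real T powr \<beta> = x powr \<beta> * (real T / x) powr \<beta>"
    using x by (simp add: powr_divide)
  also have "\<dots> \<le> x powr \<beta> * (1 - \<beta> + \<beta> * (real T / x))"
    using powr_le_convex_comb[of "real T / x" \<beta>] \<beta> x by (intro mult_left_mono) auto
  also have "\<dots> = x powr \<beta> - \<beta> * (x powr \<beta> / x)"
    unfolding x_def by (simp add: field_simps)
  finally have concave: "real T powr \<beta> \<le> x powr \<beta> - \<beta> * x powr (- \<alpha>)" unfolding x_powr .
  have "(\<Sum>t=1..Suc T. real t powr (- \<alpha>)) = (\<Sum>t=1..T. real t powr (- \<alpha>)) + x powr (- \<alpha>)"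
    by (simp add: x_def add.commute)
  also have "\<dots> \<le> real T powr \<beta> / \<beta> + x powr (- \<alpha>)" using Suc \<beta>_def by simp
  also have "\<dots> \<le> (x powr \<beta> - \<beta> * x powr (- \<alpha>)) / \<beta> + x powr (- \<alpha>)"
    using concave \<beta> by (simp add: divide_right_mono)
  also have "\<dots> = x powr \<beta> / \<beta>" using \<beta> by (simp add: field_simps)
  finally show ?case unfolding x_def \<beta>_def by (simp add: add.commute)
qed

lemma square_weighted_sum_le:
  fixes p s :: "'a \<Rightarrow> real"
  assumes "\<And>a. a \<in> I \<Longrightarrow> p a \<ge> 0" "sum p I = 1"
  shows "(\<Sum>a\<in>I. p a * s a)^2 \<le> (\<Sum>a\<in>I. p a * (s a)^2)"
proof -
  define \<mu> where "\<mu> = (\<Sum>a\<in>I. p a * s a)"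
  have "0 \<le> (\<Sum>a\<in>I. p a * (s a - \<mu>)^2)" using assms by (intro sum_nonneg) auto
  also have "\<dots> = (\<Sum>a\<in>I. p a * (s a)^2 - 2 * \<mu> * (p a * s a) + \<mu>^2 * p a)"
    by (intro sum.cong) (auto simp: power2_eq_square algebra_simps)
  also have "\<dots> = (\<Sum>a\<in>I. p a * (s a)^2) - 2 * \<mu> * \<mu> + \<mu>^2 * sum p I"
    unfolding \<mu>_def by (simp only: sum.distrib sum_subtractf sum_distrib_left)
  also have "\<dots> = (\<Sum>a\<in>I. p a * (s a)^2) - \<mu>^2" using assms(2) by (simp add: power2_eq_square)
  finally show ?thesis unfolding \<mu>_def by simp
qed

lemma le_sqrt_add_of_square_le:
  fixes D a b :: real
  assumes "D \<ge> 0" "b \<ge> 0" "a \<ge> 0" "D^2 \<le> a + b * D"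
  shows "D \<le> sqrt a + b"
proof (cases "D \<le> b")
  case True thus ?thesis using real_sqrt_ge_zero[OF assms(3)] by linarith
next
  case False
  have "(D - b)^2 \<le> D * (D - b)" using False assms by (simp add: power2_eq_square mult_right_mono)
  also have "\<dots> \<le> a" using assms by (simp add: power2_eq_square algebra_simps)
  finally have "D - b \<le> sqrt a" using False by (simp add: real_le_rsqrt)
  thus ?thesis by simp
qed

lemma weighted_exp_centred_ge_one:
  fixes q u :: "'a \<Rightarrow> real"
  assumes "\<And>a. a \<in> I \<Longrightarrow> q a \<ge> 0" "sum q I = 1" "(\<Sum>a\<in>I. q a * u a) = 0"
  shows "1 \<le> (\<Sum>a\<in>I. q a * exp (u a))"
proof -
  have "(\<Sum>a\<in>I. q a * (1 + u a)) \<le> (\<Sum>a\<in>I. q a * exp (u a))"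
    by (intro sum_mono mult_left_mono) (auto simp: assms(1) exp_ge_add_one_self)
  moreover have "(\<Sum>a\<in>I. q a * (1 + u a)) = 1"
    using assms(2,3) by (simp add: algebra_simps sum.distrib)
  ultimately show ?thesis by simp
qed

lemma weighted_exp_centred_le:
  fixes q u :: "'a \<Rightarrow> real"
  assumes q: "\<And>a. a \<in> I \<Longrightarrow> q a \<ge> 0" "sum q I = 1" "(\<Sum>a\<in>I. q a * u a) = 0"
    and u: "\<And>a. a \<in> I \<Longrightarrow> u a \<le> \<sigma>" "\<sigma> < 3"
  shows "(\<Sum>a\<in>I. q a * exp (u a)) \<le> 1 + 3/2 * (\<Sum>a\<in>I. q a * (u a)^2) / (3 - \<sigma>)"
proof -
  have exp_le: "exp (u a) \<le> 1 + u a + 3/2 * (u a)^2 / (3 - \<sigma>)" if "a \<in> I" for a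
  proof -
    have pos: "3 - u a > 0" "3 - \<sigma> > 0" using u(1)[OF that] u(2) by linarith+
    have "exp (u a) \<le> (3 + 2 * u a + (u a)^2 / 2) / (3 - u a)"
      using exp_mult_three_minus_le[of "u a"] pos by (simp add: field_simps)
    also have "\<dots> = 1 + u a + 3/2 * (u a)^2 / (3 - u a)"
      using pos by (simp add: field_simps power2_eq_square)
    also have "3/2 * (u a)^2 / (3 - u a) \<le> 3/2 * (u a)^2 / (3 - \<sigma>)"
      using pos u(1)[OF that] by (intro divide_left_mono) auto
    finally show ?thesis by simp
  qed
  have "(\<Sum>a\<in>I. q a * exp (u a)) \<le> (\<Sum>a\<in>I. q a * (1 + u a + 3/2 * (u a)^2 / (3 - \<sigma>)))"
    using exp_le q(1) by (intro sum_mono mult_left_mono) auto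
  also have "\<dots> = sum q I + (\<Sum>a\<in>I. q a * u a) + 3/2 * (\<Sum>a\<in>I. q a * (u a)^2) / (3 - \<sigma>)"
    by (simp add: algebra_simps sum.distrib sum_distrib_left sum_divide_distrib)
  finally show ?thesis using q(2,3) by simp
qed

lemma mixability_gap_centred:
  fixes q x :: "'a \<Rightarrow> real" and I :: "'a set" and \<eta> :: real
  defines "\<mu> \<equiv> (\<Sum>a\<in>I. q a * x a)"
  assumes qn: "\<And>a. a \<in> I \<Longrightarrow> q a \<ge> 0" and qs: "sum q I = 1" and eta: "\<eta> > 0"
  shows "(\<Sum>a\<in>I. q a * (\<eta> * (x a - \<mu>))) = 0"
    and "1 \<le> (\<Sum>a\<in>I. q a * exp (\<eta> * (x a - \<mu>)))"
    and "ln (\<Sum>a\<in>I. q a * exp (\<eta> * x a)) / \<eta> - \<mu> = ln (\<Sum>a\<in>I. q a * exp (\<eta> * (x a - \<mu>))) / \<eta>"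
proof -
  have "(\<Sum>a\<in>I. q a * (\<eta> * (x a - \<mu>))) = \<eta> * (\<Sum>a\<in>I. q a * x a) - \<eta> * \<mu> * (\<Sum>a\<in>I. q a)"
    by (simp add: sum_distrib_left sum_subtractf algebra_simps)
  thus centred: "(\<Sum>a\<in>I. q a * (\<eta> * (x a - \<mu>))) = 0" by (simp add: qs \<mu>_def)
  show P_ge: "1 \<le> (\<Sum>a\<in>I. q a * exp (\<eta> * (x a - \<mu>)))"
    by (rule weighted_exp_centred_ge_one[OF qn qs centred])
  have "(\<Sum>a\<in>I. q a * exp (\<eta> * x a)) = exp (\<eta> * \<mu>) * (\<Sum>a\<in>I. q a * exp (\<eta> * (x a - \<mu>)))"
    unfolding sum_distrib_left by (intro sum.cong refl) (simp add: exp_add[symmetric] algebra_simps)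
  thus "ln (\<Sum>a\<in>I. q a * exp (\<eta> * x a)) / \<eta> - \<mu> = ln (\<Sum>a\<in>I. q a * exp (\<eta> * (x a - \<mu>))) / \<eta>"
    using P_ge eta by (simp add: ln_mult field_simps)
qed

lemma mixability_gap_bounds:
  fixes q x :: "'a \<Rightarrow> real" and I :: "'a set" and \<eta> S :: real
  defines "\<mu> \<equiv> (\<Sum>a\<in>I. q a * x a)"
  defines "d \<equiv> ln (\<Sum>a\<in>I. q a * exp (\<eta> * x a)) / \<eta> - \<mu>"
  assumes qn: "\<And>a. a \<in> I \<Longrightarrow> q a \<ge> 0" and qs: "sum q I = 1"
    and eta: "\<eta> > 0" and S: "\<And>a. a \<in> I \<Longrightarrow> x a \<le> \<mu> + S"
  shows "0 \<le> d" "d \<le> S"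
proof -
  define P where "P = (\<Sum>a\<in>I. q a * exp (\<eta> * (x a - \<mu>)))"
  have P_ge: "1 \<le> P" unfolding P_def \<mu>_def by (rule mixability_gap_centred(2)[OF qn qs eta])
  have d_eq: "d = ln P / \<eta>" unfolding d_def P_def \<mu>_def by (rule mixability_gap_centred(3)[OF qn qs eta])
  show "0 \<le> d" unfolding d_eq using P_ge eta by simp
  have "exp (\<eta> * (x a - \<mu>)) \<le> exp (\<eta> * S)" if "a \<in> I" for a
    using S[OF that] eta by simp
  hence "P \<le> (\<Sum>a\<in>I. q a * exp (\<eta> * S))"
    unfolding P_def using qn by (intro sum_mono mult_left_mono) auto
  also have "\<dots> = exp (\<eta> * S)" by (simp add: sum_distrib_right[symmetric] qs)
  finally have "ln P \<le> \<eta> * S" using P_ge by (intro ln_le_of_le_exp) auto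
  thus "d \<le> S" unfolding d_eq using eta by (simp add: divide_le_eq mult.commute)
qed

lemma mixability_gap_bernstein:
  fixes q x :: "'a \<Rightarrow> real" and I :: "'a set" and \<eta> S :: real
  defines "\<mu> \<equiv> (\<Sum>a\<in>I. q a * x a)"
  defines "d \<equiv> ln (\<Sum>a\<in>I. q a * exp (\<eta> * x a)) / \<eta> - \<mu>"
  assumes qn: "\<And>a. a \<in> I \<Longrightarrow> q a \<ge> 0" and qs: "sum q I = 1"
    and eta: "\<eta> > 0" and S: "\<And>a. a \<in> I \<Longrightarrow> x a \<le> \<mu> + S"
  shows "d * (1/\<eta> - S/3) \<le> (\<Sum>a\<in>I. q a * (x a - \<mu>)^2) / 2"
proof (cases "\<eta> * S < 3")
  case False
  have "1/\<eta> - S/3 \<le> 0" using False eta by (simp add: field_simps)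
  hence "d * (1/\<eta> - S/3) \<le> 0"
    using mixability_gap_bounds(1)[OF qn qs eta S[unfolded \<mu>_def]] unfolding d_def \<mu>_def
    by (simp add: mult_nonneg_nonpos)
  moreover have "(\<Sum>a\<in>I. q a * (x a - \<mu>)^2) \<ge> 0" by (intro sum_nonneg) (simp add: qn)
  ultimately show ?thesis by linarith
next
  case True
  define u where "u a = \<eta> * (x a - \<mu>)" for a
  define P where "P = (\<Sum>a\<in>I. q a * exp (u a))"
  define w where "w = (\<Sum>a\<in>I. q a * (x a - \<mu>)^2)"
  have u_centred: "(\<Sum>a\<in>I. q a * u a) = 0"
    unfolding u_def \<mu>_def by (rule mixability_gap_centred(1)[OF qn qs eta])
  have P_ge: "1 \<le> P" unfolding P_def u_def \<mu>_def by (rule mixability_gap_centred(2)[OF qn qs eta])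
  have d_eq: "d = ln P / \<eta>" unfolding d_def P_def u_def \<mu>_def by (rule mixability_gap_centred(3)[OF qn qs eta])
  have u_le: "u a \<le> \<eta> * S" if "a \<in> I" for a
    using S[OF that] eta by (simp add: u_def)
  have "(\<Sum>a\<in>I. q a * (u a)^2) = \<eta>^2 * w"
    unfolding w_def u_def sum_distrib_left power_mult_distrib by (simp add: ac_simps)
  hence "P \<le> 1 + 3/2 * \<eta>^2 * w / (3 - \<eta> * S)"
    using weighted_exp_centred_le[OF qn qs u_centred u_le True] unfolding P_def by simp
  hence ln_P: "ln P \<le> 3/2 * \<eta>^2 * w / (3 - \<eta> * S)"
    using ln_le_minus_one[of P] P_ge by simp
  have "d * (1/\<eta> - S/3) = ln P * (3 - \<eta> * S) / (3 * \<eta>^2)"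
    unfolding d_eq using eta by (simp add: field_simps power2_eq_square)
  also have "\<dots> \<le> (3/2 * \<eta>^2 * w / (3 - \<eta> * S)) * (3 - \<eta> * S) / (3 * \<eta>^2)"
    using ln_P True eta by (intro divide_right_mono mult_right_mono) auto
  also have "\<dots> = w / 2" using True eta by (simp add: field_simps power2_eq_square)
  finally show ?thesis by (simp add: w_def)
qed

section \<open>The AdaHedge potential\<close>

lemma Max_image_ge: "(K::nat) \<ge> 1 \<Longrightarrow> a \<in> {1..K} \<Longrightarrow> (L a :: real) \<le> Max (L ` {1..K})"
  by (intro Max_ge) auto

lemma Max_image_attained:
  assumes "(K::nat) \<ge> 1" obtains a where "a \<in> {1..K}" "Max (L ` {1..K}) = (L a :: real)"
  using Max_in[of "L ` {1..K}"] assms by fastforce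

lemma Max_image_add_le:
  "(K::nat) \<ge> 1 \<Longrightarrow> Max ((\<lambda>a. (L a :: real) + x a) ` {1..K}) \<le> Max (L ` {1..K}) + Max (x ` {1..K})"
proof -
  assume K: "K \<ge> 1"
  obtain b where b: "b \<in> {1..K}" "Max ((\<lambda>a. L a + x a) ` {1..K}) = L b + x b"
    by (rule Max_image_attained[OF K])
  show ?thesis unfolding b(2) by (rule add_mono; rule Max_image_ge[OF K b(1)])
qed

lemma ahb_leaders_subset: "ahb_leaders K L \<subseteq> {1..K}"
  unfolding ahb_leaders_def by auto

lemma ahb_leaders_nonempty: "K \<ge> 1 \<Longrightarrow> ahb_leaders K L \<noteq> {}"
proof -
  assume K: "K \<ge> 1"
  obtain a where a: "a \<in> {1..K}" "Max (L ` {1..K}) = L a" using Max_image_attained[OF K] .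
  have "L b \<le> L a" if "b \<in> {1..K}" for b using Max_image_ge[OF K that, of L] a(2) by simp
  hence "a \<in> ahb_leaders K L" using a(1) by (simp add: ahb_leaders_def)
  thus ?thesis by auto
qed

lemma ahb_q_nonneg: "ahb_q K st a \<ge> 0"
  unfolding ahb_q_def Let_def by (auto intro!: divide_nonneg_pos sum_pos2 simp: sum_nonneg)

lemma ahb_q_sum: assumes "K \<ge> 1" shows "(\<Sum>a=1..K. ahb_q K st a) = 1"
proof (cases "snd st = 0")
  case True
  let ?Ld = "ahb_leaders K (fst st)"
  have "finite ?Ld" using ahb_leaders_subset finite_subset by blast
  have "(\<Sum>a=1..K. ahb_q K st a) = (\<Sum>a\<in>?Ld. 1 / real (card ?Ld))"
    using True ahb_leaders_subset[of K "fst st"]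
    by (simp add: ahb_q_def Let_def sum.If_cases Int_absorb1)
  also have "\<dots> = 1" using \<open>finite ?Ld\<close> ahb_leaders_nonempty[OF assms] by simp
  finally show ?thesis .
next
  case False
  let ?e = "\<lambda>a. exp (ahb_eta K (snd st) * fst st a)"
  have "(\<Sum>k=1..K. ?e k) > 0" using assms by (intro sum_pos) auto
  thus ?thesis using False by (simp add: ahb_q_def Let_def sum_divide_distrib[symmetric])
qed

lemma ahb_q_le_1: assumes "K \<ge> 1" "a \<in> {1..K}" shows "ahb_q K st a \<le> 1"
proof -
  have "ahb_q K st a \<le> (\<Sum>b=1..K. ahb_q K st b)"
    using assms(2) by (intro member_le_sum) (auto simp: ahb_q_nonneg)
  thus ?thesis using ahb_q_sum[OF assms(1)] by simp
qed

text \<open>The AdaHedge potential for the learning rate \<eta> = ln K / D; the value for D = 0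
  (\<eta> = \<infinity>) is its limit as \<eta> \<rightarrow> \<infinity>.\<close>

definition ahb_potential :: "nat \<Rightarrow> real \<Rightarrow> (nat \<Rightarrow> real) \<Rightarrow> real" where
  "ahb_potential K D L = (if D = 0 then Max (L ` {1..K})
     else ln ((\<Sum>a=1..K. exp (ahb_eta K D * L a)) / real K) / ahb_eta K D)"

locale ahb_arms =
  fixes K :: nat assumes K2: "K \<ge> 2"
begin

lemma K_ge_1: "K \<ge> 1" using K2 by simp

lemma ln_K_pos: "ln (real K) > 0" using K2 by simp

lemma ln_K_ge_two_thirds: "ln (real K) \<ge> 2/3"
proof -
  have "ln 2 \<le> ln (real K)" using K2 by simp
  thus ?thesis using ln2_ge_two_thirds by linarith
qed

lemma ahb_eta_pos: "D > 0 \<Longrightarrow> ahb_eta K D > 0"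
  unfolding ahb_eta_def using ln_K_pos by simp

lemma sum_exp_pos: "(\<Sum>a=1..K. exp (f a :: real)) > 0"
  using K2 by (intro sum_pos) auto

lemma ahb_potential_le_Max:
  assumes D: "D > 0" shows "ahb_potential K D L \<le> Max (L ` {1..K})"
proof -
  let ?\<eta> = "ahb_eta K D" let ?M = "Max (L ` {1..K})"
  have \<eta>: "?\<eta> > 0" using ahb_eta_pos D by simp
  have "(\<Sum>a=1..K. exp (?\<eta> * L a)) \<le> (\<Sum>a=1..K. exp (?\<eta> * ?M))"
    using K2 \<eta> by (intro sum_mono) (auto intro!: mult_left_mono Max_image_ge)
  hence "(\<Sum>a=1..K. exp (?\<eta> * L a)) / real K \<le> exp (?\<eta> * ?M)"
    using K2 by (simp add: divide_le_eq mult.commute)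
  hence "ln ((\<Sum>a=1..K. exp (?\<eta> * L a)) / real K) \<le> ?\<eta> * ?M"
    using sum_exp_pos K2 by (intro ln_le_of_le_exp) auto
  thus ?thesis unfolding ahb_potential_def using D \<eta> by (simp add: divide_le_eq mult.commute)
qed

lemma Max_le_ahb_potential_add:
  assumes D: "D > 0" shows "Max (L ` {1..K}) \<le> ahb_potential K D L + D"
proof -
  let ?\<eta> = "ahb_eta K D" let ?M = "Max (L ` {1..K})"
  have \<eta>: "?\<eta> > 0" using ahb_eta_pos D by simp
  obtain b where b: "b \<in> {1..K}" "?M = L b" by (rule Max_image_attained[OF K_ge_1])
  have "exp (?\<eta> * ?M) \<le> (\<Sum>a=1..K. exp (?\<eta> * L a))"
    unfolding b(2) using b(1) by (intro member_le_sum) auto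
  hence "ln (exp (?\<eta> * ?M) / real K) \<le> ln ((\<Sum>a=1..K. exp (?\<eta> * L a)) / real K)"
    using K2 by (intro ln_mono divide_right_mono) auto
  hence "?\<eta> * ?M - ln (real K) \<le> ln ((\<Sum>a=1..K. exp (?\<eta> * L a)) / real K)"
    using K2 by (simp add: ln_div)
  hence "(?\<eta> * ?M - ln (real K)) / ?\<eta> \<le> ahb_potential K D L"
    unfolding ahb_potential_def using D \<eta> by (simp add: divide_right_mono)
  moreover have "(?\<eta> * ?M - ln (real K)) / ?\<eta> = ?M - D"
    using \<eta> D ln_K_pos by (simp add: ahb_eta_def field_simps)
  ultimately show ?thesis by simp
qed

lemma ahb_potential_add:
  assumes D: "D > 0"
  shows "ahb_potential K D (\<lambda>a. L a + x a) = ahb_potential K D L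
     + ln (\<Sum>a=1..K. ahb_q K (L, D) a * exp (ahb_eta K D * x a)) / ahb_eta K D"
proof -
  let ?\<eta> = "ahb_eta K D"
  define Z where "Z = (\<Sum>a=1..K. exp (?\<eta> * L a))"
  define Z' where "Z' = (\<Sum>a=1..K. exp (?\<eta> * (L a + x a)))"
  have "Z > 0" "Z' > 0" unfolding Z_def Z'_def by (rule sum_exp_pos)+
  have "(\<Sum>a=1..K. ahb_q K (L, D) a * exp (?\<eta> * x a)) = (\<Sum>a=1..K. exp (?\<eta> * (L a + x a)) / Z)"
    unfolding ahb_q_def Let_def Z_def using D by (intro sum.cong) (auto simp: distrib_left exp_add)
  also have "\<dots> = Z' / Z" unfolding Z'_def by (simp add: sum_divide_distrib)
  finally have q_mix: "(\<Sum>a=1..K. ahb_q K (L, D) a * exp (?\<eta> * x a)) = Z' / Z" .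
  have "ln (Z' / real K) = ln (Z / real K) + ln (Z' / Z)"
    using \<open>Z > 0\<close> \<open>Z' > 0\<close> K2 by (simp add: ln_div)
  thus ?thesis unfolding ahb_potential_def q_mix using D by (simp add: Z_def Z'_def add_divide_distrib)
qed

lemma ahb_potential_antimono:
  assumes D: "0 < D" "D \<le> D'" shows "ahb_potential K D' L \<le> ahb_potential K D L"
proof -
  define \<eta> where "\<eta> = ahb_eta K D"
  define \<eta>' where "\<eta>' = ahb_eta K D'"
  have \<eta>: "\<eta> > 0" "\<eta>' > 0" using ahb_eta_pos D unfolding \<eta>_def \<eta>'_def by auto
  define r where "r = D / D'"
  have r: "0 < r" "r \<le> 1" using D unfolding r_def by auto
  have \<eta>'_eq: "\<eta>' = r * \<eta>" unfolding \<eta>'_def \<eta>_def ahb_eta_def r_def using D by (simp add: field_simps)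
  define m where "m = (\<Sum>a=1..K. exp (\<eta> * L a)) / real K"
  have m: "m > 0" unfolding m_def using K2 sum_exp_pos by simp
  define w where "w a = \<eta> * L a - ln m" for a
  \<comment> \<open>convexity of exp: the power mean of order r \<le> 1 is at most the arithmetic mean\<close>
  have "(\<Sum>a=1..K. exp (r * w a)) \<le> (\<Sum>a=1..K. 1 - r + r * exp (w a))"
    using r by (intro sum_mono exp_mult_le_convex_comb) auto
  also have "\<dots> = real K * (1 - r) + r * (\<Sum>a=1..K. exp (\<eta> * L a)) / m"
    using m by (simp add: w_def exp_diff sum.distrib sum_distrib_left sum_divide_distrib)
  also have "\<dots> = real K" using m K2 unfolding m_def by (simp add: field_simps)
  finally have "(\<Sum>a=1..K. exp (r * w a)) \<le> real K" .
  moreover have "exp (\<eta>' * L a) = exp (r * ln m) * exp (r * w a)" for a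
    unfolding \<eta>'_eq w_def by (simp add: exp_add[symmetric] algebra_simps)
  ultimately have "(\<Sum>a=1..K. exp (\<eta>' * L a)) / real K \<le> exp (r * ln m)"
    using K2 by (simp add: sum_distrib_left[symmetric] mult_left_le divide_le_eq)
  hence "ln ((\<Sum>a=1..K. exp (\<eta>' * L a)) / real K) \<le> r * ln m"
    using sum_exp_pos K2 by (intro ln_le_of_le_exp) auto
  hence "ln ((\<Sum>a=1..K. exp (\<eta>' * L a)) / real K) / \<eta>' \<le> r * ln m / \<eta>'"
    using \<eta> by (simp add: divide_right_mono)
  also have "r * ln m / \<eta>' = ln m / \<eta>" using r \<eta> \<eta>'_eq by simp
  finally show ?thesis unfolding ahb_potential_def using D \<eta>_def \<eta>'_def m_def by simp
qed

end

section \<open>One round of AHB\<close>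

locale ahb_analysis = ahb_arms K for K +
  fixes \<gamma> :: "nat \<Rightarrow> real" and y :: "nat \<Rightarrow> nat \<Rightarrow> real" and m M \<gamma>\<^sub>0 :: real
  assumes gamma_lower_pos: "\<gamma>\<^sub>0 > 0"
    and gamma_bounds: "\<And>t. t \<ge> 1 \<Longrightarrow> \<gamma>\<^sub>0 \<le> \<gamma> t \<and> \<gamma> t \<le> 1/2"
    and y_bounds: "\<And>t a. t \<ge> 1 \<Longrightarrow> a \<in> {1..K} \<Longrightarrow> m \<le> y t a \<and> y t a \<le> M"
begin

abbreviation "p \<equiv> ahb_p K \<gamma>"
abbreviation "C \<equiv> ahb_C K y"
abbreviation "yh \<equiv> ahb_yhat K \<gamma> y"
abbreviation "upd \<equiv> ahb_update K \<gamma> y"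

definition "est_bound = (M - m) * real K / \<gamma>\<^sub>0"
definition "iw_excess t st A = (y t A - C) / p t st A"
definition "mix_est t st A = (\<Sum>a=1..K. ahb_q K st a * yh t st A a)"
definition "est_sqdev t st A = (\<Sum>a=1..K. ahb_q K st a * (yh t st A a - C)^2)"

lemma m_le_M: "m \<le> M" using y_bounds[of 1 1] K2 by auto

lemma C_bounds: "m \<le> C \<and> C \<le> M"
proof -
  have "real K * m \<le> (\<Sum>s=1..K. y s s)" "(\<Sum>s=1..K. y s s) \<le> real K * M"
    using sum_mono[of "{1..K}" "\<lambda>_. m" "\<lambda>s. y s s"] sum_mono[of "{1..K}" "\<lambda>s. y s s" "\<lambda>_. M"]
      y_bounds by auto
  thus ?thesis unfolding ahb_C_def using K2 by (simp add: field_simps)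
qed

lemma est_bound_nonneg: "est_bound \<ge> 0"
  unfolding est_bound_def using m_le_M gamma_lower_pos by simp

lemma gamma_nonneg: "t \<ge> 1 \<Longrightarrow> \<gamma> t \<ge> 0"
  using gamma_bounds[of t] gamma_lower_pos by linarith

lemma p_ge: "t \<ge> 1 \<Longrightarrow> p t st a \<ge> \<gamma>\<^sub>0 / real K"
  using gamma_bounds[of t] ahb_q_nonneg[of K st a] unfolding ahb_p_def
  by (simp add: divide_right_mono add_increasing)

lemma p_pos: "t \<ge> 1 \<Longrightarrow> p t st a > 0"
  using p_ge[of t st a] divide_pos_pos[OF gamma_lower_pos, of "real K"] K2 by simp

lemma p_sum: "t \<ge> 1 \<Longrightarrow> (\<Sum>a=1..K. p t st a) = 1"
  using ahb_q_sum[OF K_ge_1, of st] K2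
  by (simp add: ahb_p_def sum.distrib sum_distrib_left[symmetric])

lemma q_le_2p: assumes "t \<ge> 1" shows "ahb_q K st a \<le> 2 * p t st a"
proof -
  have "ahb_q K st a * 1 \<le> ahb_q K st a * (2 * (1 - \<gamma> t))"
    using ahb_q_nonneg[of K st a] gamma_bounds[OF assms] by (intro mult_left_mono) auto
  hence "ahb_q K st a \<le> 2 * ((1 - \<gamma> t) * ahb_q K st a)" by (simp add: algebra_simps)
  also have "\<dots> \<le> 2 * p t st a" unfolding ahb_p_def using gamma_bounds[OF assms] gamma_lower_pos by simp
  finally show ?thesis .
qed

lemma yh_eq: "yh t st A a = (if a = A then iw_excess t st A else 0) + C"
  unfolding ahb_yhat_def iw_excess_def by simp

lemma abs_iw_excess_le: assumes "t \<ge> 1" "A \<in> {1..K}" shows "\<bar>iw_excess t st A\<bar> \<le> est_bound"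
proof -
  have "\<bar>y t A - C\<bar> \<le> M - m" using y_bounds[OF assms] C_bounds by auto
  hence "\<bar>y t A - C\<bar> / p t st A \<le> (M - m) / (\<gamma>\<^sub>0 / real K)"
    using p_ge[OF assms(1)] p_pos[OF assms(1)] gamma_lower_pos K2 m_le_M by (intro frac_le) auto
  thus ?thesis unfolding iw_excess_def est_bound_def using p_pos[OF assms(1), of st A] by (simp add: abs_div)
qed

lemma mix_est_eq: assumes "A \<in> {1..K}" shows "mix_est t st A = C + ahb_q K st A * iw_excess t st A"
proof -
  have "mix_est t st A = (\<Sum>a=1..K. ahb_q K st a * (if a = A then iw_excess t st A else 0))
      + C * (\<Sum>a=1..K. ahb_q K st a)"
    unfolding mix_est_def yh_eq by (simp add: distrib_left sum.distrib sum_distrib_left mult.commute)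
  thus ?thesis using assms ahb_q_sum[OF K_ge_1] by (simp add: if_distrib cong: if_cong)
qed

lemma est_sqdev_eq: assumes "A \<in> {1..K}" shows "est_sqdev t st A = ahb_q K st A * (iw_excess t st A)^2"
proof -
  have "est_sqdev t st A = (\<Sum>a=1..K. if a = A then ahb_q K st A * (iw_excess t st A)^2 else 0)"
    unfolding est_sqdev_def yh_eq by (intro sum.cong) auto
  thus ?thesis using assms by simp
qed

lemma est_sqdev_nonneg: "est_sqdev t st A \<ge> 0"
  unfolding est_sqdev_def by (intro sum_nonneg mult_nonneg_nonneg ahb_q_nonneg) auto

lemma yh_le_mix_est_add: assumes "t \<ge> 1" "A \<in> {1..K}" "a \<in> {1..K}"
  shows "yh t st A a \<le> mix_est t st A + est_bound"
proof -
  let ?q = "ahb_q K st A" let ?z = "iw_excess t st A"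
  have q: "0 \<le> ?q" "?q \<le> 1" using ahb_q_nonneg ahb_q_le_1[OF K_ge_1 assms(2)] by auto
  have z: "\<bar>?z\<bar> \<le> est_bound" using abs_iw_excess_le assms by auto
  have "\<bar>?q * ?z\<bar> \<le> \<bar>?z\<bar>" "\<bar>(1 - ?q) * ?z\<bar> \<le> \<bar>?z\<bar>"
    using q by (auto simp: abs_mult mult_left_le_one_le)
  hence "(if a = A then ?z else 0) - ?q * ?z \<le> est_bound"
    using z by (cases "a = A") (auto simp: algebra_simps)
  thus ?thesis unfolding yh_eq mix_est_eq[OF assms(2)] by simp
qed

lemma variance_le_est_sqdev: assumes "A \<in> {1..K}"
  shows "(\<Sum>a=1..K. ahb_q K st a * (yh t st A a - mix_est t st A)^2) \<le> est_sqdev t st A"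
proof -
  let ?q = "ahb_q K st" let ?x = "yh t st A" let ?\<mu> = "mix_est t st A"
  have "est_sqdev t st A - (\<Sum>a=1..K. ?q a * (?x a - ?\<mu>)^2)
      = (\<Sum>a=1..K. (?\<mu> - C) * (2 * (?q a * ?x a) - (C + ?\<mu>) * ?q a))"
    unfolding est_sqdev_def sum_subtractf[symmetric]
    by (intro sum.cong) (auto simp: power2_eq_square algebra_simps)
  also have "\<dots> = (?\<mu> - C) * (\<Sum>a=1..K. 2 * (?q a * ?x a) - (C + ?\<mu>) * ?q a)"
    by (simp add: sum_distrib_left)
  also have "\<dots> = (?\<mu> - C) * (2 * ?\<mu> - (C + ?\<mu>))"
    unfolding mix_est_def sum_subtractf sum_distrib_left[symmetric] ahb_q_sum[OF K_ge_1] by simp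
  also have "\<dots> = (?\<mu> - C)^2" by (simp add: power2_eq_square algebra_simps)
  finally show ?thesis using zero_le_power2[of "?\<mu> - C"] by linarith
qed

lemma expected_est: assumes "t \<ge> 1" "a \<in> {1..K}"
  shows "(\<Sum>A=1..K. p t st A * yh t st A a) = y t a"
proof -
  have "(\<Sum>A=1..K. p t st A * yh t st A a)
      = (\<Sum>A=1..K. (if A = a then p t st a * iw_excess t st a else 0) + C * p t st A)"
    unfolding yh_eq by (intro sum.cong) (auto simp: algebra_simps)
  also have "\<dots> = p t st a * iw_excess t st a + C"
    using assms(2) p_sum[OF assms(1)] by (simp add: sum.distrib sum_distrib_left[symmetric])
  finally show ?thesis unfolding iw_excess_def using p_pos[OF assms(1), of st a] by simp
qed

lemma expected_mix_est: assumes "t \<ge> 1"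
  shows "(\<Sum>A=1..K. p t st A * mix_est t st A) = (\<Sum>a=1..K. ahb_q K st a * y t a)"
proof -
  have "p t st A * mix_est t st A = C * p t st A + ahb_q K st A * y t A - C * ahb_q K st A"
    if "A \<in> {1..K}" for A
    unfolding mix_est_eq[OF that] iw_excess_def using p_pos[OF assms, of st A] by (simp add: field_simps)
  hence "(\<Sum>A=1..K. p t st A * mix_est t st A)
      = (\<Sum>A=1..K. C * p t st A + ahb_q K st A * y t A - C * ahb_q K st A)"
    by (rule sum.cong[OF refl])
  also have "\<dots> = C * (\<Sum>A=1..K. p t st A) + (\<Sum>A=1..K. ahb_q K st A * y t A) - C * (\<Sum>A=1..K. ahb_q K st A)"
    by (simp only: sum.distrib sum_distrib_left sum_subtractf)
  finally show ?thesis unfolding p_sum[OF assms] ahb_q_sum[OF K_ge_1] by simp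
qed

lemma expected_est_sqdev_le: assumes "t \<ge> 1"
  shows "(\<Sum>A=1..K. p t st A * est_sqdev t st A) \<le> 2 * real K * (M - m)^2"
proof -
  have "p t st A * est_sqdev t st A \<le> 2 * (M - m)^2" if A: "A \<in> {1..K}" for A
  proof -
    have p: "p t st A > 0" using p_pos assms by auto
    have "\<bar>y t A - C\<bar> \<le> \<bar>M - m\<bar>" using y_bounds[OF assms A] C_bounds by auto
    hence "(y t A - C)^2 \<le> (M - m)^2" by (simp only: abs_le_square_iff)
    moreover have "ahb_q K st A / p t st A \<le> 2" using q_le_2p[OF assms] p by (simp add: divide_le_eq)
    ultimately have "ahb_q K st A / p t st A * (y t A - C)^2 \<le> 2 * (M - m)^2"
      by (intro mult_mono) auto
    moreover have "p t st A * est_sqdev t st A = ahb_q K st A / p t st A * (y t A - C)^2"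
      unfolding est_sqdev_eq[OF A] iw_excess_def using p by (simp add: field_simps power2_eq_square)
    ultimately show ?thesis by simp
  qed
  hence "(\<Sum>A=1..K. p t st A * est_sqdev t st A) \<le> (\<Sum>A=1..K. 2 * (M - m)^2)" by (rule sum_mono)
  thus ?thesis by simp
qed

lemma q_reward_le_p_reward: assumes "t \<ge> 1"
  shows "(\<Sum>a=1..K. ahb_q K st a * y t a) \<le> (\<Sum>a=1..K. p t st a * y t a) + \<gamma> t * (M - m)"
proof -
  let ?Q = "(\<Sum>a=1..K. ahb_q K st a * y t a)"
  let ?U = "(\<Sum>a=1..K. y t a) / real K"
  have "(\<Sum>a=1..K. p t st a * y t a)
      = (\<Sum>a=1..K. (1 - \<gamma> t) * (ahb_q K st a * y t a) + \<gamma> t * (y t a / real K))"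
    unfolding ahb_p_def by (intro sum.cong) (auto simp: algebra_simps)
  also have "\<dots> = (1 - \<gamma> t) * ?Q + \<gamma> t * ?U"
    by (simp only: sum.distrib sum_distrib_left sum_divide_distrib)
  finally have p_mix: "(\<Sum>a=1..K. p t st a * y t a) = (1 - \<gamma> t) * ?Q + \<gamma> t * ?U" .
  have "?Q \<le> (\<Sum>a=1..K. ahb_q K st a * M)"
    using y_bounds[OF assms] by (intro sum_mono mult_left_mono) (auto simp: ahb_q_nonneg)
  hence "?Q \<le> M" by (simp only: sum_distrib_right[symmetric] ahb_q_sum[OF K_ge_1] mult_1)
  moreover have "(\<Sum>a=1..K. m) \<le> (\<Sum>a=1..K. y t a)" using y_bounds[OF assms] by (intro sum_mono) auto
  hence "?U \<ge> m" using K2 by (simp add: le_divide_eq mult.commute)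
  moreover have "\<gamma> t \<ge> 0" using gamma_bounds[OF assms] gamma_lower_pos by linarith
  ultimately have "\<gamma> t * (?Q - ?U) \<le> \<gamma> t * (M - m)" by (intro mult_left_mono) auto
  moreover have "?Q = (1 - \<gamma> t) * ?Q + \<gamma> t * ?U + \<gamma> t * (?Q - ?U)" by (simp add: algebra_simps)
  ultimately show ?thesis using p_mix by linarith
qed

lemma ahb_delta_infinite_eta:
  "snd st = 0 \<Longrightarrow> ahb_delta K st (yh t st A) = Max (yh t st A ` {1..K}) - mix_est t st A"
  unfolding ahb_delta_def mix_est_def Let_def by simp

lemma ahb_delta_finite_eta:
  "snd st \<noteq> 0 \<Longrightarrow> ahb_delta K st (yh t st A)
     = ln (\<Sum>a=1..K. ahb_q K st a * exp (ahb_eta K (snd st) * yh t st A a)) / ahb_eta K (snd st)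
       - mix_est t st A"
  unfolding ahb_delta_def mix_est_def Let_def by simp

lemma ahb_delta_bounds:
  assumes "t \<ge> 1" "A \<in> {1..K}" "snd st \<ge> 0"
  shows "0 \<le> ahb_delta K st (yh t st A) \<and> ahb_delta K st (yh t st A) \<le> est_bound"
proof (cases "snd st = 0")
  case True
  obtain b where b: "b \<in> {1..K}" "Max (yh t st A ` {1..K}) = yh t st A b"
    by (rule Max_image_attained[OF K_ge_1])
  have "mix_est t st A \<le> (\<Sum>a=1..K. ahb_q K st a * Max (yh t st A ` {1..K}))"
    unfolding mix_est_def by (intro sum_mono mult_left_mono Max_image_ge[OF K_ge_1]) (auto simp: ahb_q_nonneg)
  also have "\<dots> = Max (yh t st A ` {1..K})"
    by (simp only: sum_distrib_right[symmetric] ahb_q_sum[OF K_ge_1] mult_1)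
  finally show ?thesis
    using ahb_delta_infinite_eta[OF True] b yh_le_mix_est_add[OF assms(1,2) b(1), of st] by simp
next
  case False
  thus ?thesis
    using mixability_gap_bounds(1,2)[of "{1..K}" "ahb_q K st" "ahb_eta K (snd st)" "yh t st A" est_bound]
      ahb_q_nonneg ahb_q_sum[OF K_ge_1] ahb_eta_pos assms yh_le_mix_est_add[OF assms(1,2)]
    by (simp add: ahb_delta_finite_eta mix_est_def)
qed

lemma ahb_delta_bernstein:
  assumes "t \<ge> 1" "A \<in> {1..K}" "snd st > 0"
  shows "ahb_delta K st (yh t st A) * (snd st / ln (real K) - est_bound / 3) \<le> est_sqdev t st A / 2"
proof -
  let ?\<eta> = "ahb_eta K (snd st)"
  have "ahb_delta K st (yh t st A) * (1 / ?\<eta> - est_bound / 3)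
      \<le> (\<Sum>a=1..K. ahb_q K st a * (yh t st A a - mix_est t st A)^2) / 2"
    using mixability_gap_bernstein[of "{1..K}" "ahb_q K st" ?\<eta> "yh t st A" est_bound]
      ahb_q_nonneg ahb_q_sum[OF K_ge_1] ahb_eta_pos assms yh_le_mix_est_add[OF assms(1,2)]
    by (simp add: ahb_delta_finite_eta mix_est_def)
  also have "\<dots> \<le> est_sqdev t st A / 2" using variance_le_est_sqdev[OF assms(2)] by simp
  finally show ?thesis unfolding ahb_eta_def by simp
qed

end

section \<open>Expectations over a run\<close>

text \<open>ahb_expect K \<gamma> y g n t st z f is the expectation, over the n randomized rounds starting
  at round t in state st, of f evaluated at the final state and at z plus the sum of
  g s st' A over the rounds s played (in state st', with arm A).\<close>

fun ahb_expect :: "nat \<Rightarrow> (nat \<Rightarrow> real) \<Rightarrow> (nat \<Rightarrow> nat \<Rightarrow> real)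
    \<Rightarrow> (nat \<Rightarrow> (nat \<Rightarrow> real) \<times> real \<Rightarrow> nat \<Rightarrow> real) \<Rightarrow> nat \<Rightarrow> nat \<Rightarrow> (nat \<Rightarrow> real) \<times> real
    \<Rightarrow> real \<Rightarrow> ((nat \<Rightarrow> real) \<times> real \<Rightarrow> real \<Rightarrow> real) \<Rightarrow> real" where
  "ahb_expect K \<gamma> y g 0 t st z f = f st z"
| "ahb_expect K \<gamma> y g (Suc n) t st z f =
     (\<Sum>a=1..K. ahb_p K \<gamma> t st a * ahb_expect K \<gamma> y g n (Suc t) (ahb_update K \<gamma> y t st a) (z + g t st a) f)"

lemma ahb_expect_add:
  "ahb_expect K \<gamma> y g n t st z (\<lambda>s w. f1 s w + f2 s w)
     = ahb_expect K \<gamma> y g n t st z f1 + ahb_expect K \<gamma> y g n t st z f2"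
  by (induction n arbitrary: t st z) (simp_all add: distrib_left sum.distrib)

lemma ahb_expect_cmult:
  "ahb_expect K \<gamma> y g n t st z (\<lambda>s w. c * f s w) = c * ahb_expect K \<gamma> y g n t st z f"
  by (induction n arbitrary: t st z) (simp_all add: sum_distrib_left algebra_simps)

lemma ahb_expect_state_only:
  "ahb_expect K \<gamma> y g n t st z (\<lambda>s w. F s) = ahb_expect K \<gamma> y (\<lambda>_ _ _. 0) n t st 0 (\<lambda>s w. F s)"
  by (induction n arbitrary: t st z) simp_all

context ahb_analysis
begin

abbreviation "E \<equiv> ahb_expect K \<gamma> y"

lemma ahb_expect_const: "t \<ge> 1 \<Longrightarrow> E g n t st z (\<lambda>_ _. c) = c"
proof (induction n arbitrary: t st z)
  case (Suc n)
  thus ?case using p_sum[OF Suc.prems] by (simp add: sum_distrib_right[symmetric])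
qed simp

lemma ahb_expect_Suc_le:
  assumes "t \<ge> 1" "\<And>a. a \<in> {1..K} \<Longrightarrow> E g n (Suc t) (upd t st a) (z + g t st a) f \<le> h a"
  shows "E g (Suc n) t st z f \<le> (\<Sum>a=1..K. p t st a * h a)"
  unfolding ahb_expect.simps
  using assms(2) p_pos[OF assms(1), of st] by (intro sum_mono mult_left_mono) (auto intro: less_imp_le)

lemma ahb_expect_mono_invariant:
  assumes "t \<ge> 1" "Inv st z"
    and Inv_step: "\<And>s st z a. s \<ge> 1 \<Longrightarrow> Inv st z \<Longrightarrow> a \<in> {1..K} \<Longrightarrow> Inv (upd s st a) (z + g s st a)"
    and le: "\<And>st z. Inv st z \<Longrightarrow> f1 st z \<le> f2 st z"
  shows "E g n t st z f1 \<le> E g n t st z f2"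
  using assms(1,2)
proof (induction n arbitrary: t st z)
  case 0 thus ?case using le by simp
next
  case (Suc n)
  have "E g (Suc n) t st z f1 \<le> (\<Sum>a=1..K. p t st a * E g n (Suc t) (upd t st a) (z + g t st a) f2)"
    using Suc.IH Inv_step Suc.prems by (intro ahb_expect_Suc_le) simp_all
  thus ?case by simp
qed

lemma ahb_expect_mono:
  "t \<ge> 1 \<Longrightarrow> (\<And>st z. f1 st z \<le> f2 st z) \<Longrightarrow> E g n t st z f1 \<le> E g n t st z f2"
  using ahb_expect_mono_invariant[of t "\<lambda>_ _. True" st z g f1 f2 n] by auto

lemma ahb_expect_sqrt_le:
  assumes "t \<ge> 1" "\<And>st z. f st z \<ge> 0"
  shows "E g n t st z (\<lambda>s w. sqrt (f s w)) \<le> sqrt (E g n t st z f)"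
  using assms(1)
proof (induction n arbitrary: t st z)
  case 0 thus ?case by simp
next
  case (Suc n)
  let ?E = "\<lambda>a. E g n (Suc t) (upd t st a) (z + g t st a) f"
  have E_nonneg: "?E a \<ge> 0" for a
    using ahb_expect_mono[of "Suc t" "\<lambda>_ _. 0" f] ahb_expect_const assms(2) by simp
  have "E g (Suc n) t st z (\<lambda>s w. sqrt (f s w)) \<le> (\<Sum>a=1..K. p t st a * sqrt (?E a))"
    using Suc.IH Suc.prems by (intro ahb_expect_Suc_le) simp_all
  also have "\<dots> \<le> sqrt (\<Sum>a=1..K. p t st a * (sqrt (?E a))^2)"
    using p_pos[OF Suc.prems, of st] p_sum[OF Suc.prems, of st]
    by (intro real_le_rsqrt square_weighted_sum_le) (auto intro: less_imp_le)
  also have "\<dots> = sqrt (E g (Suc n) t st z f)" using E_nonneg by simp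
  finally show ?case .
qed

lemma ahb_expect_acc_le:
  assumes "t \<ge> 1" "\<And>s st. s \<ge> 1 \<Longrightarrow> (\<Sum>a=1..K. p s st a * g s st a) \<le> c"
  shows "E g n t st z (\<lambda>_ w. w) \<le> z + real n * c"
  using assms(1)
proof (induction n arbitrary: t st z)
  case 0 thus ?case by simp
next
  case (Suc n)
  have "E g (Suc n) t st z (\<lambda>_ w. w) \<le> (\<Sum>a=1..K. p t st a * (z + g t st a + real n * c))"
    using Suc.IH Suc.prems by (intro ahb_expect_Suc_le) simp_all
  also have "\<dots> = (z + real n * c) * (\<Sum>a=1..K. p t st a) + (\<Sum>a=1..K. p t st a * g t st a)"
    by (simp add: distrib_left sum.distrib sum_distrib_left sum_distrib_right algebra_simps)
  also have "\<dots> \<le> z + real n * c + c" using p_sum[OF Suc.prems] assms(2)[OF Suc.prems] by simp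
  finally show ?case by (simp add: algebra_simps)
qed

lemma ahb_expect_cumulative_est:
  assumes "t \<ge> 1" "a \<in> {1..K}"
  shows "E g n t st z (\<lambda>s w. fst s a) = fst st a + (\<Sum>s\<in>{t..<t+n}. y s a)"
  using assms(1)
proof (induction n arbitrary: t st z)
  case 0 thus ?case by simp
next
  case (Suc n)
  let ?R = "fst st a + (\<Sum>s\<in>{Suc t..<Suc t + n}. y s a)"
  have "E g (Suc n) t st z (\<lambda>s w. fst s a) = (\<Sum>A=1..K. p t st A * (?R + yh t st A a))"
    using Suc by (simp add: ahb_update_def Let_def algebra_simps)
  also have "\<dots> = ?R * (\<Sum>A=1..K. p t st A) + (\<Sum>A=1..K. p t st A * yh t st A a)"
    by (simp add: distrib_left sum.distrib sum_distrib_left sum_distrib_right algebra_simps)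
  also have "\<dots> = ?R + y t a"
    using p_sum[OF Suc.prems] expected_est[OF Suc.prems assms(2)] by simp
  finally show ?case by (simp add: sum.atLeast_Suc_lessThan)
qed

lemma ahb_expect_mix_est_le:
  assumes "t \<ge> 1"
  shows "E mix_est n t st z (\<lambda>_ w. w)
     \<le> z + ahb_exp_reward K \<gamma> y n t st + (M - m) * (\<Sum>s\<in>{t..<t+n}. \<gamma> s)"
  using assms
proof (induction n arbitrary: t st z)
  case 0 thus ?case by simp
next
  case (Suc n)
  let ?G = "(M - m) * (\<Sum>s\<in>{Suc t..<Suc t + n}. \<gamma> s)"
  let ?R = "\<lambda>a. ahb_exp_reward K \<gamma> y n (Suc t) (upd t st a)"
  have "E mix_est (Suc n) t st z (\<lambda>_ w. w) \<le> (\<Sum>a=1..K. p t st a * (z + mix_est t st a + ?R a + ?G))"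
    using Suc.IH[of "Suc t"] Suc.prems by (intro ahb_expect_Suc_le) simp_all
  also have "\<dots> = (\<Sum>a=1..K. (z + ?G) * p t st a + p t st a * mix_est t st a + p t st a * ?R a)"
    by (intro sum.cong) (auto simp: algebra_simps)
  also have "\<dots> = (z + ?G) * (\<Sum>a=1..K. p t st a) + (\<Sum>a=1..K. p t st a * mix_est t st a)
      + (\<Sum>a=1..K. p t st a * ?R a)"
    by (simp only: sum.distrib sum_distrib_left)
  also have "\<dots> \<le> z + ?G + ((\<Sum>a=1..K. p t st a * y t a) + \<gamma> t * (M - m)) + (\<Sum>a=1..K. p t st a * ?R a)"
    using p_sum[OF Suc.prems] expected_mix_est[OF Suc.prems] q_reward_le_p_reward[OF Suc.prems] by simp
  also have "\<dots> = z + ahb_exp_reward K \<gamma> y (Suc n) t st + (M - m) * (\<gamma> t + (\<Sum>s\<in>{Suc t..<Suc t + n}. \<gamma> s))"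
    by (simp add: distrib_left sum.distrib algebra_simps)
  also have "\<gamma> t + (\<Sum>s\<in>{Suc t..<Suc t + n}. \<gamma> s) = (\<Sum>s\<in>{t..<t + Suc n}. \<gamma> s)"
    by (simp add: sum.atLeast_Suc_lessThan)
  finally show ?case .
qed

section \<open>Pathwise invariants\<close>

definition "gap_coeff = 2/3 * ln (real K) + 1"

text \<open>Invariants of every run, where Q accumulates mix_est and V accumulates est_sqdev.\<close>

definition "potential_invariant st Q \<longleftrightarrow>
  snd st \<ge> 0 \<and> ahb_potential K (snd st) (fst st) - snd st \<le> Q"

definition "gap_invariant st V \<longleftrightarrow>
  snd st \<ge> 0 \<and> V \<ge> 0 \<and> (snd st)^2 \<le> ln (real K) * V + gap_coeff * est_bound * snd st"

lemma gap_coeff_ge_1: "gap_coeff \<ge> 1"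
  unfolding gap_coeff_def using ln_K_pos by simp

lemma upd_eq: "upd s st A = (\<lambda>a. fst st a + yh s st A a, snd st + ahb_delta K st (yh s st A))"
  unfolding ahb_update_def Let_def by simp

lemma potential_invariant_step:
  assumes s: "s \<ge> 1" and inv: "potential_invariant st Q" and A: "A \<in> {1..K}"
  shows "potential_invariant (upd s st A) (Q + mix_est s st A)"
proof -
  obtain L D where st: "st = (L, D)" by (cases st)
  let ?x = "yh s st A"
  let ?\<delta> = "ahb_delta K st ?x"
  let ?L' = "\<lambda>a. L a + ?x a"
  have D: "D \<ge> 0" and Q: "ahb_potential K D L - D \<le> Q" using inv st unfolding potential_invariant_def by auto
  have \<delta>: "0 \<le> ?\<delta>" using ahb_delta_bounds[OF s A] D st by simp
  have "ahb_potential K (D + ?\<delta>) ?L' - (D + ?\<delta>) \<le> Q + mix_est s st A"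
  proof (cases "D = 0")
    case True
    have "ahb_potential K (D + ?\<delta>) ?L' \<le> Max (?L' ` {1..K})"
    proof (cases "D + ?\<delta> = 0")
      case False thus ?thesis using ahb_potential_le_Max[of "D + ?\<delta>" ?L'] D \<delta> by simp
    qed (simp add: ahb_potential_def)
    also have "\<dots> \<le> Max (L ` {1..K}) + Max (?x ` {1..K})" by (rule Max_image_add_le[OF K_ge_1])
    moreover have "ahb_potential K D L = Max (L ` {1..K})" using True by (simp add: ahb_potential_def)
    ultimately show ?thesis using Q True ahb_delta_infinite_eta[of st s A] st by simp
  next
    case False
    hence "D > 0" using D by simp
    have "ahb_potential K D ?L' = ahb_potential K D L + ?\<delta> + mix_est s st A"
      using ahb_potential_add[OF \<open>D > 0\<close>, of L ?x] ahb_delta_finite_eta[of st s A] False st by simp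
    moreover have "ahb_potential K (D + ?\<delta>) ?L' \<le> ahb_potential K D ?L'"
      using ahb_potential_antimono[OF \<open>D > 0\<close>, of "D + ?\<delta>"] \<delta> by simp
    ultimately show ?thesis using Q by simp
  qed
  thus ?thesis unfolding potential_invariant_def upd_eq st using D \<delta> st by simp
qed

lemma Max_le_of_potential_invariant:
  assumes "potential_invariant st Q" shows "Max (fst st ` {1..K}) \<le> Q + 2 * snd st"
proof -
  have "Max (fst st ` {1..K}) \<le> ahb_potential K (snd st) (fst st) + snd st"
    using Max_le_ahb_potential_add[of "snd st" "fst st"] assms
    by (cases "snd st = 0") (auto simp: ahb_potential_def potential_invariant_def)
  thus ?thesis using assms unfolding potential_invariant_def by simp
qed

lemma gap_invariant_step:
  assumes s: "s \<ge> 1" and inv: "gap_invariant st V" and A: "A \<in> {1..K}"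
  shows "gap_invariant (upd s st A) (V + est_sqdev s st A)"
proof -
  obtain L D where st: "st = (L, D)" by (cases st)
  let ?\<delta> = "ahb_delta K st (yh s st A)"
  let ?v = "est_sqdev s st A"
  let ?S = "est_bound"
  have D: "D \<ge> 0" and V: "V \<ge> 0" and DV: "D^2 \<le> ln (real K) * V + gap_coeff * ?S * D"
    using inv st unfolding gap_invariant_def by auto
  have \<delta>: "0 \<le> ?\<delta>" "?\<delta> \<le> ?S" using ahb_delta_bounds[OF s A] D st by auto
  have v: "?v \<ge> 0" by (rule est_sqdev_nonneg)
  have "?\<delta>^2 \<le> ?S * ?\<delta>" using \<delta> by (simp add: power2_eq_square mult_right_mono)
  moreover have "2 * D * ?\<delta> \<le> ln (real K) * ?v + 2/3 * ln (real K) * ?S * ?\<delta>"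
  proof (cases "D = 0")
    case True thus ?thesis using ln_K_pos v \<delta> est_bound_nonneg by simp
  next
    case False
    hence "?\<delta> * (D / ln (real K) - ?S / 3) \<le> ?v / 2" using ahb_delta_bernstein[OF s A, of st] D st by simp
    hence "2 * ln (real K) * (?\<delta> * (D / ln (real K) - ?S / 3)) \<le> 2 * ln (real K) * (?v / 2)"
      using ln_K_pos by (intro mult_left_mono) auto
    moreover have "2 * D * ?\<delta> = 2 * ln (real K) * (?\<delta> * (D / ln (real K) - ?S / 3))
        + 2/3 * ln (real K) * ?S * ?\<delta>"
      using ln_K_pos by (simp add: field_simps)
    ultimately show ?thesis by simp
  qed
  moreover have "?S * ?\<delta> \<le> 1/3 * ?S * ?\<delta> + 2/3 * gap_coeff * ?S * ?\<delta>"
    using gap_coeff_ge_1 est_bound_nonneg \<delta> mult_right_mono[of 1 gap_coeff "?S * ?\<delta>"]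
    by (simp add: algebra_simps)
  ultimately have "2 * D * ?\<delta> + ?\<delta>^2 \<le> ln (real K) * ?v + gap_coeff * ?S * ?\<delta>"
    unfolding gap_coeff_def by (simp add: algebra_simps)
  hence "(D + ?\<delta>)^2 \<le> ln (real K) * (V + ?v) + gap_coeff * ?S * (D + ?\<delta>)"
    using DV by (simp add: power2_eq_square algebra_simps)
  thus ?thesis unfolding gap_invariant_def upd_eq st using D \<delta> V v st by simp
qed

lemma gap_le_of_gap_invariant:
  "gap_invariant st V \<Longrightarrow> snd st \<le> sqrt (ln (real K) * max V 0) + gap_coeff * est_bound"
  using le_sqrt_add_of_square_le[of "snd st" "gap_coeff * est_bound" "ln (real K) * V"]
    gap_coeff_ge_1 est_bound_nonneg ln_K_pos
  unfolding gap_invariant_def by (simp add: max_absorb1)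

abbreviation "st\<^sub>0 \<equiv> ((\<lambda>_. 0, 0) :: (nat \<Rightarrow> real) \<times> real)"

lemma expected_gap_le:
  "E g n (Suc K) st\<^sub>0 z (\<lambda>s w. snd s)
     \<le> sqrt (ln (real K) * (real n * (2 * real K * (M - m)^2))) + gap_coeff * est_bound"
proof -
  let ?E = "E est_sqdev n (Suc K) st\<^sub>0 0"
  have "E g n (Suc K) st\<^sub>0 z (\<lambda>s w. snd s) = ?E (\<lambda>s w. snd s)"
    using ahb_expect_state_only[of K \<gamma> y g n "Suc K" st\<^sub>0 z snd]
      ahb_expect_state_only[of K \<gamma> y est_sqdev n "Suc K" st\<^sub>0 0 snd] by simp
  also have "\<dots> \<le> ?E (\<lambda>s w. sqrt (ln (real K) * max w 0) + gap_coeff * est_bound)"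
    by (rule ahb_expect_mono_invariant[where Inv = gap_invariant,
          OF _ _ gap_invariant_step gap_le_of_gap_invariant]) (simp_all add: gap_invariant_def)
  also have "\<dots> = ?E (\<lambda>s w. sqrt (ln (real K) * max w 0)) + gap_coeff * est_bound"
    using ahb_expect_add ahb_expect_const by simp
  finally have gap: "E g n (Suc K) st\<^sub>0 z (\<lambda>s w. snd s)
      \<le> ?E (\<lambda>s w. sqrt (ln (real K) * max w 0)) + gap_coeff * est_bound" .
  have "?E (\<lambda>s w. max w 0) \<le> ?E (\<lambda>_ w. w)"
    by (rule ahb_expect_mono_invariant[of _ "\<lambda>_ w. w \<ge> 0"]) (simp_all add: add_nonneg_nonneg est_sqdev_nonneg)
  also have "\<dots> \<le> real n * (2 * real K * (M - m)^2)"
    using ahb_expect_acc_le[OF _ expected_est_sqdev_le, of "Suc K" n st\<^sub>0 0] by simp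
  finally have "ln (real K) * ?E (\<lambda>s w. max w 0) \<le> ln (real K) * (real n * (2 * real K * (M - m)^2))"
    using ln_K_pos by simp
  hence "sqrt (?E (\<lambda>s w. ln (real K) * max w 0)) \<le> sqrt (ln (real K) * (real n * (2 * real K * (M - m)^2)))"
    using ahb_expect_cmult[of K \<gamma> y est_sqdev n "Suc K" st\<^sub>0 0 "ln (real K)"] by simp
  moreover have "?E (\<lambda>s w. sqrt (ln (real K) * max w 0)) \<le> sqrt (?E (\<lambda>s w. ln (real K) * max w 0))"
    using ln_K_pos by (intro ahb_expect_sqrt_le) auto
  ultimately show ?thesis using gap by linarith
qed

text \<open>Unbiasedness turns the best cumulative reward into an expected maximum of cumulative
  estimates, which the potential invariant bounds along every run.\<close>

lemma best_cumulative_le: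
  "Max ((\<lambda>a. \<Sum>s\<in>{Suc K..<Suc K + n}. y s a) ` {1..K})
     \<le> ahb_exp_reward K \<gamma> y n (Suc K) st\<^sub>0 + (M - m) * (\<Sum>s\<in>{Suc K..<Suc K + n}. \<gamma> s)
       + 2 * (sqrt (ln (real K) * (real n * (2 * real K * (M - m)^2))) + gap_coeff * est_bound)"
  (is "_ \<le> ?R")
proof -
  let ?E = "E mix_est n (Suc K) st\<^sub>0 0"
  have "potential_invariant st\<^sub>0 0"
    using K_ge_1 by (simp add: potential_invariant_def ahb_potential_def)
  hence "?E (\<lambda>s w. Max (fst s ` {1..K})) \<le> ?E (\<lambda>s w. w + 2 * snd s)"
    by (intro ahb_expect_mono_invariant[where Inv = potential_invariant,
          OF _ _ potential_invariant_step Max_le_of_potential_invariant]) simp_all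
  also have "\<dots> = ?E (\<lambda>_ w. w) + 2 * ?E (\<lambda>s w. snd s)"
    using ahb_expect_add[of K \<gamma> y mix_est n "Suc K" st\<^sub>0 0 "\<lambda>_ w. w" "\<lambda>s w. 2 * snd s"]
      ahb_expect_cmult[of K \<gamma> y mix_est n "Suc K" st\<^sub>0 0 2 "\<lambda>s w. snd s"] by simp
  also have "\<dots> \<le> ?R"
    using ahb_expect_mix_est_le[of "Suc K" n st\<^sub>0 0] expected_gap_le[of mix_est n 0] by simp
  finally have best: "?E (\<lambda>s w. Max (fst s ` {1..K})) \<le> ?R" .
  have "(\<Sum>s\<in>{Suc K..<Suc K + n}. y s a) \<le> ?R" if "a \<in> {1..K}" for a
  proof -
    have "(\<Sum>s\<in>{Suc K..<Suc K + n}. y s a) = ?E (\<lambda>s w. fst s a)"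
      using ahb_expect_cumulative_est[OF _ that, of "Suc K" mix_est n st\<^sub>0 0] by simp
    also have "\<dots> \<le> ?E (\<lambda>s w. Max (fst s ` {1..K}))"
      using Max_image_ge[OF K_ge_1 that] by (intro ahb_expect_mono) auto
    finally show ?thesis using best by simp
  qed
  thus ?thesis using K_ge_1 by (intro Max.boundedI) auto
qed

section \<open>Regret bounds\<close>

lemma exploration_constant_le:
  "real (K - 1) * (M - m) + 2 * (gap_coeff * est_bound) \<le> 5 * (M - m) * real K * ln (real K) / \<gamma>\<^sub>0"
proof -
  define L where "L = ln (real K)"
  have \<gamma>\<^sub>0: "0 < \<gamma>\<^sub>0" "\<gamma>\<^sub>0 \<le> 1/2" using gamma_lower_pos gamma_bounds[of 1] by auto
  have "(real K - 1) / 2 + 2 * real K \<le> 11/3 * (real K * L)"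
  proof (cases "K = 2")
    case True thus ?thesis using ln_K_ge_two_thirds unfolding L_def by simp
  next
    case False
    hence "exp 1 \<le> real K" using K2 exp_le by linarith
    hence "1 \<le> L" unfolding L_def using ln_ge_iff[of "real K" 1] K2 by simp
    hence "real K * 1 \<le> real K * L" by (intro mult_left_mono) auto
    moreover have "real K \<ge> 2" using K2 by simp
    ultimately show ?thesis by argo
  qed
  moreover have "(real K - 1) * \<gamma>\<^sub>0 \<le> (real K - 1) / 2" using \<gamma>\<^sub>0 K2 by (simp add: mult_left_mono)
  ultimately have "(real K - 1) * \<gamma>\<^sub>0 + 2 * gap_coeff * real K \<le> 5 * real K * L"
    unfolding gap_coeff_def L_def by (simp add: algebra_simps) argo
  hence "((real K - 1) * \<gamma>\<^sub>0 + 2 * gap_coeff * real K) * (M - m) / \<gamma>\<^sub>0 \<le> 5 * real K * L * (M - m) / \<gamma>\<^sub>0"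
    using m_le_M \<gamma>\<^sub>0 by (intro divide_right_mono mult_right_mono) auto
  moreover have "((real K - 1) * \<gamma>\<^sub>0 + 2 * gap_coeff * real K) * (M - m) / \<gamma>\<^sub>0
      = real (K - 1) * (M - m) + 2 * (gap_coeff * est_bound)"
    unfolding est_bound_def using \<gamma>\<^sub>0 K_ge_1 by (simp add: of_nat_diff field_simps)
  moreover have "5 * real K * L * (M - m) / \<gamma>\<^sub>0 = 5 * (M - m) * real K * ln (real K) / \<gamma>\<^sub>0"
    unfolding L_def by (simp add: ac_simps)
  ultimately show ?thesis by simp
qed

lemma variance_term_le: assumes "n \<le> T"
  shows "2 * sqrt (ln (real K) * (real n * (2 * real K * (M - m)^2)))
    \<le> 3 * (M - m) * sqrt (real K * real T * ln (real K))"
proof -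
  have sqrt4: "sqrt 4 = (2::real)" and sqrt9: "sqrt 9 = (3::real)" by (rule real_sqrt_unique; simp)+
  have "2 * sqrt (ln (real K) * (real n * (2 * real K * (M - m)^2)))
      = sqrt (4 * (ln (real K) * (real n * (2 * real K * (M - m)^2))))"
    by (simp only: real_sqrt_mult sqrt4)
  also have "\<dots> \<le> sqrt (9 * (M - m)^2 * (real K * real T * ln (real K)))"
  proof (rule real_sqrt_le_mono)
    have "(8 * real n) * (real K * ln (real K) * (M - m)^2) \<le> (9 * real T) * (real K * ln (real K) * (M - m)^2)"
      using assms ln_K_pos by (intro mult_right_mono) auto
    thus "4 * (ln (real K) * (real n * (2 * real K * (M - m)^2))) \<le> 9 * (M - m)^2 * (real K * real T * ln (real K))"
      by (simp add: algebra_simps)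
  qed
  also have "\<dots> = 3 * (M - m) * sqrt (real K * real T * ln (real K))"
    using m_le_M by (simp only: real_sqrt_mult sqrt9 real_sqrt_abs)
  finally show ?thesis .
qed

lemma regret_short_horizon:
  assumes "T \<le> K" shows "ahb_regret K \<gamma> y T \<le> real T * (M - m)"
proof -
  have "(\<Sum>t=1..T. y t a) \<le> (\<Sum>t=1..T. y t t) + real T * (M - m)" if "a \<in> {1..K}" for a
  proof -
    have "y t a \<le> y t t + (M - m)" if "t \<in> {1..T}" for t
      using y_bounds[of t a] y_bounds[of t t] \<open>a \<in> {1..K}\<close> that assms by auto
    hence "(\<Sum>t=1..T. y t a) \<le> (\<Sum>t=1..T. y t t + (M - m))" by (rule sum_mono)
    thus ?thesis by (simp add: sum.distrib)
  qed
  hence "Max ((\<lambda>a. \<Sum>t=1..T. y t a) ` {1..K}) \<le> (\<Sum>t=1..T. y t t) + real T * (M - m)"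
    using K_ge_1 by (intro Max.boundedI) auto
  thus ?thesis using assms unfolding ahb_regret_def ahb_total_def by simp
qed

lemma cumulative_first_rounds_le: assumes "a \<in> {1..K}"
  shows "(\<Sum>t=1..K. y t a) \<le> (\<Sum>t=1..K. y t t) + real (K - 1) * (M - m)"
proof -
  have "(\<Sum>t=1..K. y t a - y t t) = (\<Sum>t\<in>{1..K} - {a}. y t a - y t t)"
    using assms by (simp add: sum.remove)
  also have "\<dots> \<le> (\<Sum>t\<in>{1..K} - {a}. M - m)"
  proof (rule sum_mono)
    fix t assume "t \<in> {1..K} - {a}"
    thus "y t a - y t t \<le> M - m" using y_bounds[of t a] y_bounds[of t t] assms by auto
  qed
  also have "\<dots> = real (K - 1) * (M - m)" using assms by simp
  finally show ?thesis by (simp add: sum_subtractf)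
qed

lemma regret_long_horizon:
  "ahb_regret K \<gamma> y (K + n) \<le> real (K - 1) * (M - m) + (M - m) * (\<Sum>t=K+1..K+n. \<gamma> t)
     + 2 * (sqrt (ln (real K) * (real n * (2 * real K * (M - m)^2))) + gap_coeff * est_bound)"
proof -
  have rounds: "{1..K + n} = {1..K} \<union> {Suc K..<Suc K + n}" "{Suc K..<Suc K + n} = {K+1..K+n}" by auto
  have "(\<Sum>t=1..K+n. y t a) \<le> (\<Sum>t=1..K. y t t) + real (K - 1) * (M - m)
      + Max ((\<lambda>a. \<Sum>s\<in>{Suc K..<Suc K + n}. y s a) ` {1..K})" if "a \<in> {1..K}" for a
  proof -
    have "(\<Sum>t=1..K+n. y t a) = (\<Sum>t=1..K. y t a) + (\<Sum>s\<in>{Suc K..<Suc K + n}. y s a)"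
      unfolding rounds(1) by (rule sum.union_disjoint) auto
    moreover have "(\<Sum>s\<in>{Suc K..<Suc K + n}. y s a) \<le> Max ((\<lambda>a. \<Sum>s\<in>{Suc K..<Suc K + n}. y s a) ` {1..K})"
      by (rule Max_image_ge[OF K_ge_1 that])
    ultimately show ?thesis using cumulative_first_rounds_le[OF that] by linarith
  qed
  hence "Max ((\<lambda>a. \<Sum>t=1..K+n. y t a) ` {1..K}) \<le> (\<Sum>t=1..K. y t t) + real (K - 1) * (M - m)
      + Max ((\<lambda>a. \<Sum>s\<in>{Suc K..<Suc K + n}. y s a) ` {1..K})"
    using K_ge_1 by (intro Max.boundedI) auto
  thus ?thesis using best_cumulative_le[of n] unfolding ahb_regret_def ahb_total_def rounds(2) by simp
qed

lemma regret_le: assumes "T \<ge> 1"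
  shows "ahb_regret K \<gamma> y T \<le> 3 * (M - m) * sqrt (real K * real T * ln (real K))
    + 5 * (M - m) * real K * ln (real K) / \<gamma>\<^sub>0 + (M - m) * (\<Sum>t=K+1..T. \<gamma> t)"
proof (cases "T \<le> K")
  case True
  have "real T * real T \<le> real K * real T" using True by (intro mult_right_mono) auto
  moreover have "real K * real T * (2/3) \<le> real K * real T * ln (real K)"
    using ln_K_ge_two_thirds by (intro mult_left_mono) auto
  moreover have "real K * real T \<ge> 0" by simp
  ultimately have "sqrt (real T * real T) \<le> sqrt (9 * (real K * real T * ln (real K)))"
    by (intro real_sqrt_le_mono) linarith
  hence "real T \<le> 3 * sqrt (real K * real T * ln (real K))" by (simp add: real_sqrt_mult)
  hence "real T * (M - m) \<le> 3 * sqrt (real K * real T * ln (real K)) * (M - m)"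
    using m_le_M by (intro mult_right_mono) auto
  moreover have "(M - m) * (\<Sum>t=K+1..T. \<gamma> t) \<ge> 0"
    using m_le_M gamma_nonneg by (intro mult_nonneg_nonneg sum_nonneg) auto
  moreover have "5 * (M - m) * real K * ln (real K) / \<gamma>\<^sub>0 \<ge> 0"
    using m_le_M ln_K_pos gamma_lower_pos by simp
  ultimately show ?thesis using regret_short_horizon[OF True] by (simp add: algebra_simps)
next
  case False
  hence "K + (T - K) = T" by simp
  hence "ahb_regret K \<gamma> y T \<le> real (K - 1) * (M - m) + (M - m) * (\<Sum>t=K+1..T. \<gamma> t)
     + 2 * (sqrt (ln (real K) * (real (T - K) * (2 * real K * (M - m)^2))) + gap_coeff * est_bound)"
    using regret_long_horizon[of "T - K"] by simp
  moreover have "r \<le> B + C + S" if "r \<le> A + S + 2 * (X + Y)" "2 * X \<le> B" "A + 2 * Y \<le> C"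
    for r A S X Y B C :: real
    using that by argo
  ultimately show ?thesis using variance_term_le[OF diff_le_self, of T K] exploration_constant_le by blast
qed

end

lemma ahb_exp_reward_cong:
  "(\<And>s. t \<le> s \<Longrightarrow> s < t + n \<Longrightarrow> \<gamma> s = \<gamma>' s) \<Longrightarrow>
   ahb_exp_reward K \<gamma> y n t st = ahb_exp_reward K \<gamma>' y n t st"
proof (induction n arbitrary: t st)
  case (Suc n)
  have \<gamma>_t: "\<gamma> t = \<gamma>' t" using Suc.prems by simp
  have "ahb_p K \<gamma> t st a = ahb_p K \<gamma>' t st a" for a
    unfolding ahb_p_def \<gamma>_t ..
  moreover have "ahb_update K \<gamma> y t st a = ahb_update K \<gamma>' y t st a" for a
    unfolding ahb_update_def ahb_yhat_def ahb_p_def \<gamma>_t ..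
  moreover have "ahb_exp_reward K \<gamma> y n (Suc t) st' = ahb_exp_reward K \<gamma>' y n (Suc t) st'" for st'
    using Suc.IH Suc.prems by auto
  ultimately show ?case by (simp only: ahb_exp_reward.simps)
qed simp

lemma antimono_from_one:
  fixes \<gamma> :: "nat \<Rightarrow> real"
  assumes "\<forall>t\<ge>1. \<gamma> (Suc t) \<le> \<gamma> t" "1 \<le> s" "s \<le> t"
  shows "\<gamma> t \<le> \<gamma> s"
  using assms(3)
proof (induction t rule: dec_induct)
  case (step t)
  thus ?case using assms(1,2) by (meson le_trans order_trans)
qed simp

lemma ahb_regret_bound:
  fixes K :: nat and \<gamma> :: "nat \<Rightarrow> real"
  assumes K2: "K \<ge> 2" and antimono: "\<forall>t\<ge>1. \<gamma> (Suc t) \<le> \<gamma> t"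
    and \<gamma>: "\<forall>t\<ge>1. 0 \<le> \<gamma> t \<and> \<gamma> t \<le> 1/2"
    and y: "\<forall>t\<ge>1. \<forall>a\<in>{1..K}. m \<le> y t a \<and> y t a \<le> M" and T: "T \<ge> 1" and \<gamma>T: "\<gamma> T > 0"
  shows "ahb_regret K \<gamma> y T
    \<le> 3 * (M - m) * sqrt (real K * real T * ln (real K))
      + 5 * (M - m) * real K * ln (real K) / \<gamma> T + (M - m) * (\<Sum>t=K+1..T. \<gamma> t)"
proof -
  \<comment> \<open>The rates after T do not influence the regret up to T; freezing them at \<gamma> T
    makes \<gamma> T a lower bound for all of them.\<close>
  define \<gamma>' where "\<gamma>' t = (if t \<le> T then \<gamma> t else \<gamma> T)" for t
  interpret ahb_analysis K \<gamma>' y m M "\<gamma> T"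
  proof
    show "\<gamma> T \<le> \<gamma>' t \<and> \<gamma>' t \<le> 1/2" if "1 \<le> t" for t
      using antimono_from_one[OF antimono that, of T] \<gamma> that T unfolding \<gamma>'_def by auto
  qed (use K2 \<gamma>T y in auto)
  have "ahb_exp_reward K \<gamma> y (T - K) (Suc K) st\<^sub>0 = ahb_exp_reward K \<gamma>' y (T - K) (Suc K) st\<^sub>0"
    by (rule ahb_exp_reward_cong) (auto simp: \<gamma>'_def)
  hence "ahb_regret K \<gamma> y T = ahb_regret K \<gamma>' y T" by (simp add: ahb_regret_def ahb_total_def)
  moreover have "(\<Sum>t=K+1..T. \<gamma>' t) = (\<Sum>t=K+1..T. \<gamma> t)" unfolding \<gamma>'_def by simp
  ultimately show ?thesis using regret_le[OF T] by simp
qed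

lemma min_half_powr_schedule:
  fixes \<gamma> :: "nat \<Rightarrow> real" and c \<alpha> :: real
  assumes \<gamma>: "\<And>t. \<gamma> t = min (1/2) (c / real t powr \<alpha>)" and "c > 0" "\<alpha> > 0"
  shows "\<forall>t\<ge>1. \<gamma> (Suc t) \<le> \<gamma> t" "\<forall>t\<ge>1. 0 \<le> \<gamma> t \<and> \<gamma> t \<le> 1/2" "\<And>t. t \<ge> 1 \<Longrightarrow> \<gamma> t > 0"
proof -
  have "c / real (Suc t) powr \<alpha> \<le> c / real t powr \<alpha>" if "t \<ge> 1" for t
    using assms(2,3) that by (intro divide_left_mono powr_mono2) auto
  thus "\<forall>t\<ge>1. \<gamma> (Suc t) \<le> \<gamma> t" unfolding \<gamma> using min.mono[OF order_refl] by blast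
  show pos: "\<gamma> t > 0" if "t \<ge> 1" for t unfolding \<gamma> using assms(2) that by simp
  have "\<gamma> t \<le> 1/2" for t unfolding \<gamma> by (rule min.cobounded1)
  thus "\<forall>t\<ge>1. 0 \<le> \<gamma> t \<and> \<gamma> t \<le> 1/2" using pos by (auto intro: less_imp_le)
qed

lemma inverse_min_half_le: "c > 0 \<Longrightarrow> x > 0 \<Longrightarrow> 1 / min (1/2) (c / x) \<le> 2 + x / c" for c x :: real
  by (cases "1/2 \<le> c / x") (auto simp: min_def)

lemma sum_min_half_powr_le:
  fixes c \<alpha> :: real
  assumes "c \<ge> 0" "0 < \<alpha>" "\<alpha> < 1"
  shows "(\<Sum>t=K+1..T. min (1/2) (c / real t powr \<alpha>)) \<le> c * real T powr (1 - \<alpha>) / (1 - \<alpha>)"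
proof -
  have "(\<Sum>t=K+1..T. min (1/2) (c / real t powr \<alpha>)) \<le> (\<Sum>t=1..T. min (1/2) (c / real t powr \<alpha>))"
    using assms(1) by (intro sum_mono2) auto
  also have "\<dots> \<le> (\<Sum>t=1..T. c * real t powr (- \<alpha>))"
    by (intro sum_mono) (simp add: powr_minus_divide)
  also have "\<dots> \<le> c * (real T powr (1 - \<alpha>) / (1 - \<alpha>))"
    unfolding sum_distrib_left[symmetric] using sum_powr_neg_le[OF assms(2,3)] assms(1)
    by (intro mult_left_mono) auto
  finally show ?thesis by simp
qed

lemma powr_schedule_exploration_le:
  fixes K T :: nat and \<alpha> L d :: real
  assumes K: "K \<ge> 1" and L: "L > 0" and d: "d \<ge> 0" and \<alpha>: "0 < \<alpha>" "\<alpha> < 1" and T: "T \<ge> 1"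
  defines "\<gamma> \<equiv> \<lambda>t::nat. min (1/2) (sqrt (5 * (1 - \<alpha>) * real K * L) / real t powr \<alpha>)"
  shows "5 * d * real K * L / \<gamma> T + d * (\<Sum>t=K+1..T. \<gamma> t)
    \<le> 10 * d * real K * L + 5 / sqrt (1 - \<alpha>) * (d * sqrt (real K * L) * real T powr (max \<alpha> (1 - \<alpha>)))"
proof -
  define B where "B = sqrt (real K * L)"
  define s where "s = sqrt (1 - \<alpha>)"
  define r5 where "r5 = sqrt (5::real)"
  define c where "c = sqrt (5 * (1 - \<alpha>) * real K * L)"
  define P where "P = real T powr (max \<alpha> (1 - \<alpha>))"
  have B: "B > 0" "B * B = real K * L" unfolding B_def using L K by auto
  have s: "s > 0" "s * s = 1 - \<alpha>" unfolding s_def using \<alpha> by auto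
  have "sqrt 5 \<le> (5/2::real)" by (rule real_le_lsqrt) (auto simp: power2_eq_square)
  hence r5: "r5 > 0" "r5 * r5 = 5" "2 * r5 \<le> 5" unfolding r5_def by auto
  have c: "c = r5 * s * B" unfolding c_def s_def B_def r5_def by (simp only: real_sqrt_mult mult.assoc)
  have c_pos: "c > 0" using s B r5 c by simp
  have T_pos: "real T powr \<alpha> > 0" using T by simp
  have P: "real T powr \<alpha> \<le> P" "real T powr (1 - \<alpha>) \<le> P" "0 \<le> P"
    using T unfolding P_def by (auto intro!: powr_mono)
  have "5 * real K * L = r5 * B * (r5 * B)" using r5(2) B(2) by (simp add: ac_simps)
  hence KL_c: "5 * real K * L / c = r5 * B / s" unfolding c using s B r5 by (simp add: field_simps)
  have "5 * d * real K * L / \<gamma> T = 5 * d * real K * L * (1 / \<gamma> T)" by simp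
  also have "\<dots> \<le> 5 * d * real K * L * (2 + real T powr \<alpha> / c)"
    using inverse_min_half_le[OF c_pos T_pos] d L unfolding \<gamma>_def c_def by (intro mult_left_mono) auto
  also have "\<dots> = 10 * d * real K * L + d * real T powr \<alpha> * (5 * real K * L / c)"
    using c_pos by (simp add: field_simps)
  also have "\<dots> = 10 * d * real K * L + r5 * (d * B * real T powr \<alpha> / s)"
    unfolding KL_c by (simp add: ac_simps)
  also have "\<dots> \<le> 10 * d * real K * L + r5 * (d * B * P / s)"
    using P(1) d B s r5 by (intro add_left_mono mult_left_mono divide_right_mono) auto
  finally have inverse: "5 * d * real K * L / \<gamma> T \<le> 10 * d * real K * L + r5 * (d * B * P / s)" .
  have "d * (\<Sum>t=K+1..T. \<gamma> t) \<le> d * (c * real T powr (1 - \<alpha>) / (1 - \<alpha>))"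
    unfolding \<gamma>_def c_def using sum_min_half_powr_le[of c \<alpha>] c_pos \<alpha> d
    by (intro mult_left_mono) (auto simp: c_def)
  also have "\<dots> = r5 * (d * B * real T powr (1 - \<alpha>) / s)"
    unfolding c s(2)[symmetric] using s by (simp add: field_simps)
  also have "\<dots> \<le> r5 * (d * B * P / s)"
    using P(2) d B s r5 by (intro mult_left_mono divide_right_mono) auto
  finally have sum: "d * (\<Sum>t=K+1..T. \<gamma> t) \<le> r5 * (d * B * P / s)" .
  have "d * B * P / s \<ge> 0" using d B s P(3) by simp
  hence "2 * r5 * (d * B * P / s) \<le> 5 * (d * B * P / s)" using r5(3) by (rule mult_right_mono[rotated])
  moreover have "5 / sqrt (1 - \<alpha>) * (d * sqrt (real K * L) * real T powr (max \<alpha> (1 - \<alpha>)))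
      = 5 * (d * B * P / s)"
    unfolding B_def s_def P_def by simp
  ultimately show ?thesis using inverse sum by argo
qed

lemma ahb_regret_bound_powr:
  fixes K :: nat and \<alpha> :: real
  assumes K2: "K \<ge> 2" and \<alpha>: "0 < \<alpha>" "\<alpha> < 1" and "m < M"
    and y: "\<forall>t\<ge>1. \<forall>a\<in>{1..K}. m \<le> y t a \<and> y t a \<le> M" and T: "T \<ge> 1"
  defines "\<gamma> \<equiv> \<lambda>t::nat. min (1/2) (sqrt (5 * (1 - \<alpha>) * real K * ln (real K)) / (real t powr \<alpha>))"
  shows "ahb_regret K \<gamma> y T
    \<le> (3 + 5 / sqrt (1 - \<alpha>)) * (M - m) * sqrt (real K * ln (real K)) * real T powr (max \<alpha> (1 - \<alpha>))
      + 10 * (M - m) * real K * ln (real K)"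
proof -
  define L where "L = ln (real K)"
  define d where "d = M - m"
  define P where "P = real T powr (max \<alpha> (1 - \<alpha>))"
  have L: "L > 0" unfolding L_def using K2 by simp
  have d: "d > 0" unfolding d_def using \<open>m < M\<close> by simp
  have c_pos: "sqrt (5 * (1 - \<alpha>) * real K * L) > 0" using L K2 \<alpha> by simp
  have \<gamma>_def': "\<gamma> t = min (1/2) (sqrt (5 * (1 - \<alpha>) * real K * L) / real t powr \<alpha>)" for t
    unfolding \<gamma>_def L_def ..
  note schedule = min_half_powr_schedule[OF \<gamma>_def' c_pos \<alpha>(1)]
  have regret: "ahb_regret K \<gamma> y T \<le> 3 * d * sqrt (real K * real T * L)
      + (5 * d * real K * L / \<gamma> T + d * (\<Sum>t=K+1..T. \<gamma> t))"
    using ahb_regret_bound[OF K2 schedule(1,2) y T schedule(3)[OF T]] unfolding d_def L_def by simp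
  have "real T powr (1/2) \<le> P"
    using T unfolding P_def by (intro powr_mono) (auto simp: le_max_iff_disj)
  hence "sqrt (real T) \<le> P" by (simp add: powr_half_sqrt)
  hence "sqrt (real K * L) * sqrt (real T) \<le> sqrt (real K * L) * P" using L by (intro mult_left_mono) auto
  hence "3 * d * sqrt (real K * real T * L) \<le> 3 * (d * sqrt (real K * L) * P)"
    using d by (simp add: real_sqrt_mult ac_simps mult_left_mono)
  moreover have "5 * d * real K * L / \<gamma> T + d * (\<Sum>t=K+1..T. \<gamma> t)
      \<le> 10 * d * real K * L + 5 / sqrt (1 - \<alpha>) * (d * sqrt (real K * L) * P)"
    using powr_schedule_exploration_le[of K L d \<alpha> T] K2 L d \<alpha> T unfolding \<gamma>_def L_def P_def by simp
  moreover have "(3 + 5 / sqrt (1 - \<alpha>)) * (M - m) * sqrt (real K * ln (real K)) * P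
      = 3 * (d * sqrt (real K * L) * P) + 5 / sqrt (1 - \<alpha>) * (d * sqrt (real K * L) * P)"
    unfolding d_def L_def by (simp only: distrib_right mult.assoc)
  ultimately show ?thesis using regret unfolding P_def d_def L_def by argo
qed

theorem theorem2:
  fixes K :: nat
  assumes K2: "K \<ge> 2"
  shows
   "(\<forall>\<gamma> :: nat \<Rightarrow> real.
       (\<forall>t\<ge>1. \<gamma> (Suc t) \<le> \<gamma> t) \<and> (\<forall>t\<ge>1. 0 \<le> \<gamma> t \<and> \<gamma> t \<le> 1/2) \<longrightarrow>
       (\<forall>(m::real) (M::real) (y :: nat \<Rightarrow> nat \<Rightarrow> real) (T::nat).
          m < M \<and> (\<forall>t\<ge>1. \<forall>a\<in>{1..K}. m \<le> y t a \<and> y t a \<le> M) \<and> T \<ge> 1 \<and> \<gamma> T > 0 \<longrightarrow>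
          ahb_regret K \<gamma> y T
            \<le> 3 * (M - m) * sqrt (real K * real T * ln (real K))
              + 5 * (M - m) * real K * ln (real K) / \<gamma> T
              + (M - m) * (\<Sum>t=K+1..T. \<gamma> t)))
    \<and>
    (\<forall>\<alpha>::real. 0 < \<alpha> \<and> \<alpha> < 1 \<longrightarrow>
       (let \<gamma> = (\<lambda>t::nat. min (1/2) (sqrt (5 * (1 - \<alpha>) * real K * ln (real K)) / (real t powr \<alpha>)))
        in \<forall>(m::real) (M::real) (y :: nat \<Rightarrow> nat \<Rightarrow> real) (T::nat).
          m < M \<and> (\<forall>t\<ge>1. \<forall>a\<in>{1..K}. m \<le> y t a \<and> y t a \<le> M) \<and> T \<ge> 1 \<longrightarrow>
          ahb_regret K \<gamma> y T
            \<le> (3 + 5 / sqrt (1 - \<alpha>)) * (M - m) * sqrt (real K * ln (real K))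
                * real T powr (max \<alpha> (1 - \<alpha>))
              + 10 * (M - m) * real K * ln (real K)))"
  unfolding Let_def
  by (intro conjI allI impI; elim conjE)
    (rule ahb_regret_bound[OF K2] ahb_regret_bound_powr[OF K2]; assumption)+

end
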